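(* Let $f\colon[0,1)\to[0,1)$ be the Rényi map. For any $\alpha\in[2,\infty]$ and any $\boldsymbol\phi=(\phi_i)_{i=1}^\infty\in\mathcal F^{\mathbb N}$ such that $\phi_i$ is bounded for every $i\ge1$, the set of all $x\in(0,1)\setminus\mathbb Q$ satisfying $$\lim_{n\to\infty}\frac1nS_n\phi_i(x)=\phi_i(0)\quad\text{for all }i\ge1,$$ $$\lim_{n\to\infty}\frac1n\log|(f^n)'x|=0,\qquad\text{and}\qquad\lim_{n\to\infty}\frac1n\sum_{j=1}^nb_j(x)=\alpha$$ has Hausdorff dimension $1$.
   Context: The Rényi map is $f(x)=\frac1{1-x}-\left\lfloor\frac1{1-x}\right\rfloor$, $x\in[0,1)$, with Markov partition $\Delta_i=[1-\frac1i,1-\frac1{i+1})$, $i\ge1$. For $x\in(0,1)\setminus\mathbb Q$ and $j\ge1$, the $j$-th digit of the backward continued fraction expansion is $b_j(x)=\left\lfloor\frac1{1-f^{j-1}x}\right\rfloor+1\ge2$. Write $S_n\phi=\sum_{j=0}^{n-1}\phi\circ f^j$. For a word $\omega=\omega_0\cdots\omega_{n-1}$ of positive integers put $\Delta_\omega=\bigcap_{j=0}^{n-1}f^{-j}\Delta_{\omega_j}$. For $\phi\colon[0,1)\to\mathbb R$ put $D_n(\phi)=\sup_\omega\sup_{x,y\in\Delta_\omega}(S_n\phi(x)-S_n\phi(y))$, the outer supremum over all words $\omega$ of positive integers of length $n$. $\mathcal F$ is the set of $\phi\colon[0,1)\to\mathbb R$ with $D_1(\phi)<\infty$ and $D_n(\phi)=o(n)$,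 and $\mathcal F^{\mathbb N}$ is the set of sequences in $\mathcal F$. *)

theory Defs
  imports "HOL-Analysis.Analysis"
begin

section \<open>Hausdorff measure and dimension\<close>

text \<open>The case distinction implements the convention that the 0-th power of the diameter of a
  nonempty set is 1 (whereas \<open>0 powr 0 = 0\<close> in the library).\<close>

definition diam_pow :: "real \<Rightarrow> 'a::metric_space set \<Rightarrow> ennreal" where
  "diam_pow s U = (if U = {} then 0 else if s = 0 then 1 else ennreal (diameter U powr s))"

text \<open>Boundedness is required explicitly because \<open>diameter\<close> is unspecified on unbounded sets.\<close>

definition delta_covers :: "real \<Rightarrow> 'a::metric_space set \<Rightarrow> (nat \<Rightarrow> 'a set) set" where
  "delta_covers \<delta> A = {U. A \<subseteq> (\<Union>i. U i) \<and> (\<forall>i. bounded (U i) \<and> diameter (U i) \<le> \<delta>)}"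

definition hausdorff_premeasure :: "real \<Rightarrow> real \<Rightarrow> 'a::metric_space set \<Rightarrow> ennreal" where
  "hausdorff_premeasure s \<delta> A = (INF U\<in>delta_covers \<delta> A. \<Sum>i. diam_pow s (U i))"

definition hausdorff_measure :: "real \<Rightarrow> 'a::metric_space set \<Rightarrow> ennreal" where
  "hausdorff_measure s A = (SUP \<delta>\<in>{0<..}. hausdorff_premeasure s \<delta> A)"

definition hausdorff_dim :: "'a::metric_space set \<Rightarrow> ereal" where
  "hausdorff_dim A = (INF s\<in>{s. 0 \<le> s \<and> hausdorff_measure s A = 0}. ereal s)"


section \<open>The Renyi map\<close>

text \<open>Functions on \<open>[0,1)\<close> are represented by total functions on the reals of which only the values
  on \<open>{0..<1}\<close> (an invariant set of the map below) are used.\<close>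

definition renyi :: "real \<Rightarrow> real" where
  "renyi x = 1 / (1 - x) - of_int \<lfloor>1 / (1 - x)\<rfloor>"

definition renyi_digit :: "nat \<Rightarrow> real \<Rightarrow> int" where
  "renyi_digit j x = \<lfloor>1 / (1 - (renyi ^^ (j - 1)) x)\<rfloor> + 1"

definition birkhoff_sum :: "nat \<Rightarrow> (real \<Rightarrow> real) \<Rightarrow> real \<Rightarrow> real" where
  "birkhoff_sum n \<phi> x = (\<Sum>j<n. \<phi> ((renyi ^^ j) x))"

definition renyi_cell :: "nat \<Rightarrow> real set" where
  "renyi_cell i = {1 - 1 / real i ..< 1 - 1 / (real i + 1)}"

definition renyi_cylinder :: "nat list \<Rightarrow> real set" where
  "renyi_cylinder w = {x \<in> {0..<1}. \<forall>j<length w. (renyi ^^ j) x \<in> renyi_cell (w ! j)}"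

definition pos_words :: "nat \<Rightarrow> nat list set" where
  "pos_words n = {w. length w = n \<and> (\<forall>k\<in>set w. 1 \<le> k)}"

definition distortion :: "nat \<Rightarrow> (real \<Rightarrow> real) \<Rightarrow> ereal" where
  "distortion n \<phi> =
     (SUP w\<in>pos_words n. SUP x\<in>renyi_cylinder w. SUP y\<in>renyi_cylinder w.
        ereal (birkhoff_sum n \<phi> x - birkhoff_sum n \<phi> y))"

definition mild_distortion :: "(real \<Rightarrow> real) set" where
  "mild_distortion =
     {\<phi>. distortion 1 \<phi> < \<infinity> \<and> (\<lambda>n. distortion n \<phi> / ereal (real n)) \<longlonglongrightarrow> 0}"

end

theory Submission
  imports Defs "HOL-Real_Asymp.Real_Asymp"
begin

text \<open>The point 0 is a neutral fixed point of the Renyi map \<open>f\<close>: on \<open>(0, 1/2)\<close> it satisfies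
  \<open>1 / f x = 1 / x - 1\<close>. Regular continued fractions are therefore the right coordinates. The orbit of
  \<open>x = [0; a\<^sub>0, b\<^sub>0, a\<^sub>1, b\<^sub>1, \<dots>]\<close> consists of blocks: the \<open>i\<close>-th block makes \<open>a\<^sub>i - 1\<close> steps with
  digit 2 in \<open>[0, 1/2)\<close>, then one step with digit \<open>b\<^sub>i + 2\<close>, and takes time \<open>a\<^sub>i\<close> (locale
  \<open>renyi_block\<close>).

  Suppose that \<open>m\<close> blocks take a time growing faster than \<open>m\<close> (locale \<open>renyi_blocks\<close>). Then errors
  that are bounded on every block disappear in the averages, and the three limits follow block by
  block. A function with mild distortion differs on a block from its value at 0 by \<open>o(a\<^sub>i) + O(1)\<close> in
  total, because the block except for its last step shares the cylinder of the word \<open>1 \<dots> 1\<close> with the fixed point. The logarithm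
  of the derivative grows by \<open>O(ln a\<^sub>i + ln b\<^sub>i)\<close>, again \<open>o(a\<^sub>i) + O(1)\<close> if \<open>b\<^sub>i\<close> is polynomially bounded
  in \<open>a\<^sub>i\<close>. The sum of the first \<open>n\<close> digits is \<open>2 * n\<close> plus the sum of the \<open>b\<^sub>i\<close> of completed blocks, so
  its average is governed by the ratio of \<open>b\<^sub>i\<close> to \<open>a\<^sub>i\<close>, which can be chosen at will.

  A set of such points of dimension near 1 is obtained from the continued fractions with digits at
  most \<open>N\<close>, whose dimension tends to 1 as \<open>N\<close> grows, by prescribing the pair \<open>(a\<^sub>i, b\<^sub>i)\<close> whenever \<open>i\<close> is a
  square, with \<open>a\<^sub>i = i + 2\<close>. The prescribed \<open>a\<^sub>i\<close> with \<open>i < m\<close> add up to order \<open>m powr (3/2)\<close>, which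
  dominates \<open>m\<close>. On the other hand they are so few and so small that the lengths of cylinders shrink only by a
  factor \<open>exp (- O (sqrt m * ln m))\<close>, which is negligible against the exponential gain
  available at the free positions (\<open>cylinder_size_powr_le_sum_children\<close>). So for every \<open>s < 1\<close> the set
  keeps nonzero \<open>s\<close>-dimensional measure (\<open>hausdorff_measure_prescribed_digits_nonzero\<close>); this is a mass
  distribution argument carried out directly on the tree of words (locale \<open>weighted_tree\<close>).\<close>

section \<open>Upper bound for the Hausdorff dimension\<close>

lemma hausdorff_measure_mono:
  "A \<subseteq> B \<Longrightarrow> hausdorff_measure s A \<le> hausdorff_measure s B"
  unfolding hausdorff_measure_def hausdorff_premeasure_def
  by (intro SUP_mono' INF_superset_mono) (auto simp: delta_covers_def)

lemma hausdorff_premeasure_unit_interval_le: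
  assumes "0 < n" "1 / real n \<le> \<delta>" "1 < s"
  shows "hausdorff_premeasure s \<delta> {0..<1::real} \<le> ennreal (real n powr (1 - s))"
proof -
  define U where "U i = (if i < n then {real i / n .. (real i + 1) / n} else {})" for i :: nat
  have diam: "diameter (U i) = (if i < n then 1 / n else 0)" for i
    using assms by (auto simp: U_def diameter_closed_interval field_simps)
  have "x \<in> (\<Union>i. U i)" if "x \<in> {0..<1}" for x :: real
  proof -
    define i where "i = nat \<lfloor>n * x\<rfloor>"
    have i: "real i = of_int \<lfloor>n * x\<rfloor>" using that by (simp add: i_def)
    have "real i \<le> n * x" "n * x < real i + 1" unfolding i by linarith+
    moreover have "n * x < real n * 1" using that assms by (intro mult_strict_left_mono) auto
    ultimately have "real i < real n" by linarith
    then have "i < n" by simp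
    moreover have "x \<in> {real i / n .. (real i + 1) / n}"
      using assms \<open>real i \<le> n * x\<close> \<open>n * x < real i + 1\<close> by (auto simp: field_simps)
    ultimately show ?thesis unfolding U_def by auto
  qed
  then have "U \<in> delta_covers \<delta> {0..<1}"
    using assms diam by (auto simp: delta_covers_def U_def intro: order_trans[OF _ assms(2)])
  then have "hausdorff_premeasure s \<delta> {0..<1::real} \<le> (\<Sum>i. diam_pow s (U i))"
    unfolding hausdorff_premeasure_def by (rule INF_lower)
  also have "\<dots> = (\<Sum>i<n. diam_pow s (U i))"
    by (rule suminf_finite) (auto simp: U_def diam_pow_def)
  also have "\<dots> \<le> (\<Sum>i<n. ennreal ((1 / n) powr s))"
    using assms diam by (intro sum_mono) (auto simp: diam_pow_def)
  also have "\<dots> = ennreal (n * (1 / n) powr s)"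
    by (simp add: ennreal_mult ennreal_of_nat_eq_real_of_nat)
  also have "n * (1 / n) powr s = real n powr (1 - s)"
    using assms by (simp add: powr_diff powr_divide)
  finally show ?thesis .
qed

lemma hausdorff_measure_unit_interval:
  assumes "1 < s"
  shows "hausdorff_measure s {0..<1::real} = 0"
proof -
  have "hausdorff_premeasure s \<delta> {0..<1::real} \<le> 0" if "0 < \<delta>" for \<delta>
  proof (rule tendsto_lowerbound)
    have "(\<lambda>n. real n powr (1 - s)) \<longlonglongrightarrow> 0"
      using assms by real_asymp
    then show "(\<lambda>n. ennreal (real n powr (1 - s))) \<longlonglongrightarrow> 0"
      by (metis ennreal_0 tendsto_ennrealI)
    have "\<forall>\<^sub>F n in sequentially. 1 / real n < \<delta>"
      using that by real_asymp
    then show "\<forall>\<^sub>F n in sequentially.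
        hausdorff_premeasure s \<delta> {0..<1::real} \<le> ennreal (real n powr (1 - s))"
      using eventually_gt_at_top[of "0::nat"]
      by eventually_elim (use assms in \<open>auto intro: hausdorff_premeasure_unit_interval_le\<close>)
  qed simp
  then show ?thesis unfolding hausdorff_measure_def
    by (intro antisym SUP_least) auto
qed

lemma hausdorff_dim_le_1:
  assumes "A \<subseteq> {0..<1::real}"
  shows "hausdorff_dim A \<le> 1"
proof (rule ereal_le_epsilon2)
  fix e :: real assume "0 < e"
  then have "hausdorff_measure (1 + e) A = 0"
    using hausdorff_measure_mono[OF assms, of "1 + e"] hausdorff_measure_unit_interval by simp
  then show "hausdorff_dim A \<le> 1 + ereal e"
    using \<open>0 < e\<close> unfolding hausdorff_dim_def
    by (intro INF_lower2[of "1 + e"]) (auto simp: one_ereal_def)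
qed

section \<open>Weighted trees and a lower bound for the Hausdorff measure\<close>

definition prefix :: "nat \<Rightarrow> (nat \<Rightarrow> 'a) \<Rightarrow> 'a list" where
  "prefix n d = map d [0..<n]"

lemma prefix_Suc: "prefix (Suc n) d = prefix n d @ [d n]"
  by (simp add: prefix_def)

lemma prefix_0 [simp]: "prefix 0 d = []"
  by (simp add: prefix_def)

lemma length_prefix [simp]: "length (prefix n d) = n"
  by (simp add: prefix_def)

lemma prefix_eq_iff: "prefix n d = prefix n e \<longleftrightarrow> (\<forall>i<n. d i = e i)"
  by (auto simp: prefix_def)

text \<open>The sets of words extending distinct children of \<open>w\<close> are disjoint, and all of
  them extend \<open>w\<close>; so a cost carried by words is superadditive in the children.\<close>

lemma sum_suminf_children_le:
  fixes c :: "nat \<Rightarrow> ennreal" and t :: "nat \<Rightarrow> 'a list"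
  assumes "finite B"
  shows "(\<Sum>a\<in>B. \<Sum>i. if \<exists>u. t i = w @ [a] @ u then c i else 0)
      \<le> (\<Sum>i. if \<exists>u. t i = w @ u then c i else 0)"
proof -
  have "(\<Sum>a\<in>B. \<Sum>i. if \<exists>u. t i = w @ [a] @ u then c i else 0)
      = (\<Sum>i. \<Sum>a\<in>B. if \<exists>u. t i = w @ [a] @ u then c i else 0)"
    by (rule suminf_sum[symmetric]) auto
  also have "\<dots> \<le> (\<Sum>i. if \<exists>u. t i = w @ u then c i else 0)"
  proof (intro suminf_le allI summableI)
    fix i
    show "(\<Sum>a\<in>B. if \<exists>u. t i = w @ [a] @ u then c i else 0)
      \<le> (if \<exists>u. t i = w @ u then c i else 0)"
    proof (cases "\<exists>a u. a \<in> B \<and> t i = w @ [a] @ u")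
      case True
      then obtain a u where a: "a \<in> B" "t i = w @ [a] @ u" by blast
      have "(\<Sum>a\<in>B. if \<exists>u. t i = w @ [a] @ u then c i else 0)
          = (\<Sum>a'\<in>{a}. if \<exists>u. t i = w @ [a'] @ u then c i else 0)"
        using a assms by (intro sum.mono_neutral_right) auto
      then show ?thesis using a by auto
    next
      case False
      then have "(\<Sum>a\<in>B. if \<exists>u. t i = w @ [a] @ u then c i else 0) = 0"
        by (intro sum.neutral) auto
      then show ?thesis by simp
    qed
  qed
  finally show ?thesis .
qed

text \<open>A mass distribution principle on the level of words. Words with \<open>i\<close>-th letter in
  \<open>A i\<close> form a tree, and \<open>\<pi>\<close> sends an infinite branch to a point. The weight \<open>v w\<close> plays the
  role of a power of the diameter of the cylinder of \<open>w\<close>, corrected by a factor that depends on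
  the depth. Assumption \<open>children\<close> says that refining a cover by cylinders cannot make it cheaper,
  and \<open>separated\<close> that a set meeting two different children of \<open>w\<close> is about as expensive
  as \<open>w\<close>.\<close>

locale weighted_tree =
  fixes A :: "nat \<Rightarrow> 'a set" and v :: "'a list \<Rightarrow> real"
    and \<pi> :: "(nat \<Rightarrow> 'a) \<Rightarrow> 'b::metric_space" and s C :: real
  assumes fin: "finite (A n)" and nonneg: "0 \<le> v w" and root: "0 < v []"
    and children: "\<lbrakk>\<And>i. d i \<in> A i\<rbrakk> \<Longrightarrow> v (prefix n d) \<le> (\<Sum>a\<in>A n. v (prefix n d @ [a]))"
    and null: "\<lbrakk>\<And>i. d i \<in> A i\<rbrakk> \<Longrightarrow> (\<lambda>n. v (prefix n d)) \<longlonglongrightarrow> 0"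
    and s_nonneg: "0 \<le> s" and C_pos: "0 < C"
    and nonempty: "A n \<noteq> {}"
    and separated: "\<lbrakk>\<And>i. d i \<in> A i; \<And>i. e i \<in> A i; prefix n d = prefix n e; d n \<noteq> e n\<rbrakk>
        \<Longrightarrow> v (prefix n d) \<le> C * dist (\<pi> d) (\<pi> e) powr s"
begin

abbreviation "branches \<equiv> {d. \<forall>i. d i \<in> A i}"

text \<open>A set of a cover can be replaced by the cylinder of the longest word shared by all
  branches that it meets, at the price of the factor \<open>C\<close>. If it meets a single branch there is no
  longest such word; the weights along the branch tend to 0, so a sufficiently deep word costs
  at most \<open>\<eta>\<close>.\<close>

lemma word_for_set:
  assumes "bounded V" "d0 \<in> branches" "\<pi> d0 \<in> V" "0 < \<eta>"
  shows "\<exists>t. (\<forall>e\<in>branches. \<pi> e \<in> V \<longrightarrow> prefix (length t) e = t) \<and>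
      ennreal (v t) \<le> ennreal C * diam_pow s V + ennreal \<eta>"
proof (cases "\<exists>n. \<exists>d\<in>branches. \<exists>e\<in>branches. \<pi> d \<in> V \<and> \<pi> e \<in> V \<and> d n \<noteq> e n")
  case False
  obtain n where "v (prefix n d0) < \<eta>"
    using order_tendstoD(2)[OF null, of d0 \<eta>] assms by (auto simp: eventually_sequentially)
  moreover have "prefix n e = prefix n d0" if "e \<in> branches" "\<pi> e \<in> V" for e
    using False assms that by (auto simp: prefix_eq_iff)
  ultimately show ?thesis
    by (intro exI[of _ "prefix n d0"]) (auto intro!: add_increasing ennreal_leI)
next
  case True
  \<comment> \<open>The common word ends at the first position where two branches meeting \<open>V\<close> disagree.\<close>
  define Q where "Q n \<longleftrightarrow> (\<exists>d\<in>branches. \<exists>e\<in>branches. \<pi> d \<in> V \<and> \<pi> e \<in> V \<and> d n \<noteq> e n)" for n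
  define n where "n = (LEAST n. Q n)"
  have "Q n" using True LeastI_ex[of Q] unfolding n_def Q_def by blast
  then obtain d e where de: "d \<in> branches" "e \<in> branches" "\<pi> d \<in> V" "\<pi> e \<in> V" "d n \<noteq> e n"
    unfolding Q_def by blast
  have below: "\<not> Q i" if "i < n" for i using that not_less_Least unfolding n_def by blast
  have same: "prefix n g = prefix n d" if "g \<in> branches" "\<pi> g \<in> V" for g
  proof (unfold prefix_eq_iff, intro allI impI, rule ccontr)
    fix i assume "i < n" "g i \<noteq> d i"
    then have "Q i" using that de(1,3) unfolding Q_def by blast
    then show False using below \<open>i < n\<close> by blast
  qed
  have "v (prefix n d) \<le> C * dist (\<pi> d) (\<pi> e) powr s"
    using de same[of e] by (intro separated) auto
  moreover have "ennreal (C * dist (\<pi> d) (\<pi> e) powr s) \<le> ennreal C * diam_pow s V"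
  proof (cases "s = 0")
    case True
    then show ?thesis using de C_pos by (auto simp: diam_pow_def intro!: ennreal_leI)
  next
    case False
    have "dist (\<pi> d) (\<pi> e) powr s \<le> diameter V powr s"
      using s_nonneg de by (intro powr_mono2 diameter_bounded_bound assms) auto
    then show ?thesis using False de C_pos
      by (auto simp: diam_pow_def ennreal_mult[symmetric] intro!: ennreal_leI)
  qed
  ultimately have "ennreal (v (prefix n d)) \<le> ennreal C * diam_pow s V + ennreal \<eta>"
    by (meson add_increasing2 ennreal_leI order_trans zero_le)
  then show ?thesis using same by (intro exI[of _ "prefix n d"]) auto
qed

text \<open>A family of words cheaper than the root cannot block every branch. Call a word solvent if
  the family members extending it cost less than its weight. The root is solvent, and every solvent
  word has a solvent child because costs are superadditive over children while weights are
  subadditive. Following solvent children gives the branch.\<close>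

lemma escaping_branch:
  fixes t :: "nat \<Rightarrow> 'a list" and c :: "nat \<Rightarrow> ennreal"
  assumes "(\<Sum>i. c i) < ennreal (v [])"
  shows "\<exists>d\<in>branches. \<forall>i. prefix (length (t i)) d = t i \<longrightarrow> c i < ennreal (v (t i))"
proof -
  \<comment> \<open>\<open>R w\<close> is the cost of the family members extending \<open>w\<close>; \<open>P\<close> is solvency.\<close>
  define R where "R w = (\<Sum>i. if \<exists>u. t i = w @ u then c i else 0)" for w
  define P where "P n w \<longleftrightarrow> R w < ennreal (v w) \<and> (\<exists>d\<in>branches. w = prefix n d)" for n w
  have "\<exists>x. P 0 x"
    using assms nonempty unfolding P_def R_def
    by (intro exI[of _ "[]"]) (auto intro!: exI[of _ "\<lambda>i. SOME a. a \<in> A i"] simp: some_in_eq)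
  moreover have "\<exists>y. P (Suc n) y \<and> (\<exists>a. y = x @ [a])" if "P n x" for x n
  proof -
    obtain d where d: "d \<in> branches" "x = prefix n d" using \<open>P n x\<close> unfolding P_def by blast
    have "\<exists>a\<in>A n. R (x @ [a]) < ennreal (v (x @ [a]))"
    proof (rule ccontr)
      assume "\<not> ?thesis"
      then have "(\<Sum>a\<in>A n. ennreal (v (x @ [a]))) \<le> (\<Sum>a\<in>A n. R (x @ [a]))"
        by (intro sum_mono) (auto simp: not_less)
      also have "\<dots> \<le> R x"
        using sum_suminf_children_le[OF fin, of t x c n] by (simp add: R_def)
      finally have "ennreal (\<Sum>a\<in>A n. v (x @ [a])) \<le> R x"
        using nonneg by (subst (asm) sum_ennreal) auto
      moreover have "ennreal (v x) \<le> ennreal (\<Sum>a\<in>A n. v (x @ [a]))"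
        using children[of d n] d by (intro ennreal_leI) auto
      ultimately show False using \<open>P n x\<close> unfolding P_def by (meson leD order_trans)
    qed
    then obtain a where a: "a \<in> A n" "R (x @ [a]) < ennreal (v (x @ [a]))" by blast
    have "x @ [a] = prefix (Suc n) (d(n := a))"
      using d by (simp add: prefix_Suc prefix_eq_iff)
    moreover have "d(n := a) \<in> branches" using a d by auto
    ultimately show ?thesis using a unfolding P_def by blast
  qed
  ultimately obtain g where g: "\<And>n. P n (g n)" "\<And>n. \<exists>a. g (Suc n) = g n @ [a]"
    using dependent_nat_choice[of P "\<lambda>n x y. \<exists>a. y = x @ [a]"] by metis
  define d where "d n = last (g (Suc n))" for n
  have pre: "prefix n d = g n" for n
  proof (induction n)
    case 0 then show ?case using g(1)[of 0] by (simp add: P_def)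
  next
    case (Suc n)
    obtain a where "g (Suc n) = g n @ [a]" using g(2) by blast
    then show ?case using Suc by (simp add: prefix_Suc d_def)
  qed
  have "d n \<in> A n" for n
  proof -
    obtain e where "e \<in> branches" "g (Suc n) = prefix (Suc n) e"
      using g(1)[of "Suc n"] unfolding P_def by blast
    then show ?thesis unfolding d_def by (simp add: prefix_Suc)
  qed
  moreover have "c i < ennreal (v (t i))" if "prefix (length (t i)) d = t i" for i
  proof -
    have "c i = (\<Sum>j\<in>{i}. if \<exists>u. t j = t i @ u then c j else 0)" by simp
    also have "\<dots> \<le> R (t i)" unfolding R_def by (intro sum_le_suminf) auto
    also have "\<dots> < ennreal (v (t i))"
      using g(1)[of "length (t i)"] that pre[of "length (t i)"] unfolding P_def by simp
    finally show ?thesis .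
  qed
  ultimately show ?thesis by (intro bexI[of _ d]) auto
qed

text \<open>If the measure vanished, some cover would be so cheap that its replacement by cylinders
  costs less than the root. A branch that escapes all of these cylinders still leads to a point of
  the set, hence into a member of the cover, and so through the cylinder chosen for that member.\<close>

lemma hausdorff_measure_branches_nonzero: "hausdorff_measure s (\<pi> ` branches) \<noteq> 0"
proof
  assume "hausdorff_measure s (\<pi> ` branches) = 0"
  moreover have "hausdorff_premeasure s 1 (\<pi> ` branches) \<le> hausdorff_measure s (\<pi> ` branches)"
    unfolding hausdorff_measure_def by (intro SUP_upper) auto
  ultimately have "hausdorff_premeasure s 1 (\<pi> ` branches) = 0" by simp
  also have "0 < ennreal (v [] / (2 * C))" using root C_pos by simp
  finally obtain U where U: "U \<in> delta_covers 1 (\<pi> ` branches)"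
      "(\<Sum>i. diam_pow s (U i)) < ennreal (v [] / (2 * C))"
    unfolding hausdorff_premeasure_def by (auto simp: INF_less_iff)
  \<comment> \<open>Half of the budget \<open>v []\<close> goes to the cover, the other half to the errors \<open>\<eta> i\<close>.\<close>
  define \<eta> where "\<eta> i = v [] / 2 * (1/2) ^ Suc i" for i :: nat
  define meets where "meets i \<longleftrightarrow> (\<exists>d\<in>branches. \<pi> d \<in> U i)" for i
  have "0 < \<eta> i" for i using root by (simp add: \<eta>_def)
  moreover have "bounded (U i)" for i using U(1) by (simp add: delta_covers_def)
  ultimately have "\<forall>i. \<exists>t. meets i \<longrightarrow> (\<forall>e\<in>branches. \<pi> e \<in> U i \<longrightarrow> prefix (length t) e = t) \<and>
      ennreal (v t) \<le> ennreal C * diam_pow s (U i) + ennreal (\<eta> i)"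
    using word_for_set unfolding meets_def by meson
  from choice[OF this] obtain t where t:
      "\<And>i e. \<lbrakk>meets i; e \<in> branches; \<pi> e \<in> U i\<rbrakk> \<Longrightarrow> prefix (length (t i)) e = t i"
      "\<And>i. meets i \<Longrightarrow> ennreal (v (t i)) \<le> ennreal C * diam_pow s (U i) + ennreal (\<eta> i)"
    by blast
  define c where "c i = ennreal C * diam_pow s (U i) + ennreal (\<eta> i)" for i
  have "\<eta> sums (v [] / 2 * 1)"
    unfolding \<eta>_def by (intro sums_mult power_half_series)
  then have "(\<Sum>i. ennreal (\<eta> i)) = ennreal (v [] / 2)"
    using root by (subst suminf_ennreal2) (auto simp: \<eta>_def sums_iff)
  then have "(\<Sum>i. c i) = ennreal C * (\<Sum>i. diam_pow s (U i)) + ennreal (v [] / 2)"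
    unfolding c_def by (subst suminf_add[symmetric]) (auto simp: ennreal_suminf_cmult)
  also have "\<dots> < ennreal C * ennreal (v [] / (2 * C)) + ennreal (v [] / 2)"
    using U(2) C_pos by (simp add: ennreal_mult_strict_left_mono ennreal_add_left_cancel_less)
  also have "\<dots> = ennreal (v [])"
    using C_pos root by (simp flip: ennreal_mult ennreal_plus)
  finally obtain d where d: "d \<in> branches"
      "\<And>i. prefix (length (t i)) d = t i \<Longrightarrow> c i < ennreal (v (t i))"
    using escaping_branch[of c t] by blast
  obtain i where "\<pi> d \<in> U i" using U(1) d(1) unfolding delta_covers_def by blast
  then have "meets i" using d(1) unfolding meets_def by blast
  then show False using t d \<open>\<pi> d \<in> U i\<close> unfolding c_def by (meson leD)
qed

end

section \<open>Infinite continued fractions\<close>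

text \<open>The continued fraction \<open>[0; d 0, d 1, \<dots>]\<close> truncated after \<open>2 * n\<close> digits. An even number of
  inversions is an increasing map, so these truncations increase with \<open>n\<close>.\<close>

fun even_convergent :: "nat \<Rightarrow> (nat \<Rightarrow> nat) \<Rightarrow> real" where
  "even_convergent 0 d = 0"
| "even_convergent (Suc n) d =
     1 / (real (d 0) + 1 / (real (d 1) + even_convergent n (\<lambda>i. d (i + 2))))"

lemma even_convergent_bounds:
  assumes "\<And>i. 1 \<le> d i"
  shows "0 \<le> even_convergent n d \<and> even_convergent n d \<le> 1"
  using assms
proof (induction n arbitrary: d)
  case (Suc n)
  have "0 \<le> even_convergent n (\<lambda>i. d (i + 2))" using Suc by auto
  moreover have "1 \<le> real (d 0)" "1 \<le> real (d 1)" using Suc.prems by auto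
  ultimately have "0 \<le> 1 / (real (d 1) + even_convergent n (\<lambda>i. d (i + 2)))" by simp
  moreover from this have "1 \<le> real (d 0) + 1 / (real (d 1) + even_convergent n (\<lambda>i. d (i + 2)))"
    using \<open>1 \<le> real (d 0)\<close> by linarith
  ultimately show ?case by (simp add: divide_le_eq)
qed simp

lemma pair_step_mono:
  fixes a b u v :: real
  assumes "0 < a" "0 < b" "0 \<le> u" "u \<le> v"
  shows "1 / (a + 1 / (b + u)) \<le> 1 / (a + 1 / (b + v))"
  using assms by (intro divide_left_mono add_left_mono mult_pos_pos add_pos_nonneg) auto

lemma even_convergent_mono:
  assumes "\<And>i. 1 \<le> d i"
  shows "even_convergent n d \<le> even_convergent (Suc n) d"
  using assms
proof (induction n arbitrary: d)
  case 0
  then show ?case using even_convergent_bounds[of d "Suc 0"] by simp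
next
  case (Suc n)
  define d' where "d' = (\<lambda>i. d (i + 2))"
  have d': "\<And>i. 1 \<le> d' i" using Suc.prems by (simp add: d'_def)
  have "even_convergent n d' \<le> even_convergent (Suc n) d'" using Suc.IH[of d'] d' by blast
  moreover have "0 \<le> even_convergent n d'" using even_convergent_bounds[of d' n] d' by blast
  moreover have "0 < real (d 0)" "0 < real (d 1)"
    using Suc.prems[of 0] Suc.prems[of 1] by auto
  ultimately show ?case
    unfolding even_convergent.simps(2)[of n d] even_convergent.simps(2)[of "Suc n" d] d'_def[symmetric]
    by (intro pair_step_mono)
qed

text \<open>\<open>y n\<close> is the tail \<open>[0; d n, d (n + 1), \<dots>]\<close>. Describing a continued fraction by the relation
  between its tails avoids convergents in all later arguments.\<close>

definition cf_tails :: "(nat \<Rightarrow> nat) \<Rightarrow> (nat \<Rightarrow> real) \<Rightarrow> bool" where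
  "cf_tails d y \<longleftrightarrow> (\<forall>n. 1 \<le> d n \<and> 0 < y n \<and> y n < 1 \<and> y n = 1 / (real (d n) + y (Suc n)))"

lemma cf_tailsD:
  assumes "cf_tails d y"
  shows "1 \<le> d n" "0 < y n" "y n < 1" "y n = 1 / (real (d n) + y (Suc n))"
  using assms unfolding cf_tails_def by blast+

lemma cf_tails_exist:
  assumes d: "\<And>i. 1 \<le> d i"
  shows "\<exists>y. cf_tails d y"
proof -
  define z where "z m = lim (\<lambda>n. even_convergent n (\<lambda>i. d (i + m)))" for m
  have conv: "(\<lambda>n. even_convergent n (\<lambda>i. d (i + m))) \<longlonglongrightarrow> z m" for m
  proof -
    have "incseq (\<lambda>n. even_convergent n (\<lambda>i. d (i + m)))"
      by (intro incseq_SucI even_convergent_mono d)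
    moreover have "\<bar>even_convergent n (\<lambda>i. d (i + m))\<bar> \<le> 1" for n
      using even_convergent_bounds[of "\<lambda>i. d (i + m)" n] d by simp
    ultimately have "convergent (\<lambda>n. even_convergent n (\<lambda>i. d (i + m)))"
      by (intro Bseq_mono_convergent BseqI'[of _ 1]) (auto simp: incseq_def)
    then show ?thesis unfolding z_def by (simp add: convergent_LIMSEQ_iff)
  qed
  have nonneg: "0 \<le> z m" for m
    using even_convergent_bounds d by (intro LIMSEQ_le_const[OF conv]) auto
  have d': "1 \<le> real (d m)" for m using d[of m] by simp
  have pos: "0 < real (d m) + z m'" for m m' using nonneg[of m'] d'[of m] by linarith
  \<comment> \<open>Only truncations of even length were used, so the limit satisfies a two-step recursion; the
    tails of odd index are defined from it.\<close>
  have z: "z m = 1 / (real (d m) + 1 / (real (d (m + 1)) + z (m + 2)))" for m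
  proof (rule LIMSEQ_unique)
    show "(\<lambda>n. even_convergent (Suc n) (\<lambda>i. d (i + m))) \<longlonglongrightarrow> z m"
      using conv by (rule LIMSEQ_Suc)
    have "0 < 1 / (real (d (m + 1)) + z (m + 2))" using pos by simp
    then have "real (d m) + 1 / (real (d (m + 1)) + z (m + 2)) \<noteq> 0" using d'[of m] by linarith
    moreover have "(\<lambda>i. d (i + 2 + m)) = (\<lambda>i. d (i + (m + 2)))" by (simp add: ac_simps)
    ultimately show "(\<lambda>n. even_convergent (Suc n) (\<lambda>i. d (i + m)))
        \<longlonglongrightarrow> 1 / (real (d m) + 1 / (real (d (m + 1)) + z (m + 2)))"
      using pos[of "m + 1" "m + 2"] conv[of "m + 2"]
      by (auto simp: ac_simps intro!: tendsto_intros)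
  qed
  define y where "y n = (if even n then z n else 1 / (real (d n) + z (n + 1)))" for n
  have y: "y n = 1 / (real (d n) + y (Suc n))" for n
    using z[of n] by (auto simp: y_def)
  have y_pos: "0 < y n" for n
  proof -
    have "0 \<le> y (Suc n)" using nonneg pos by (auto simp: y_def less_imp_le)
    then show ?thesis using d'[of n] by (subst y) simp
  qed
  moreover have "y n < 1" for n
    using d'[of n] y_pos[of "Suc n"] by (subst y) (auto simp: divide_less_eq)
  ultimately show ?thesis using d y unfolding cf_tails_def by blast
qed

text \<open>Infinite descent: if \<open>y n = p / q\<close> then \<open>y (n + 1)\<close> is rational with denominator
  \<open>p < q\<close>.\<close>

lemma cf_tails_irrational:
  assumes "cf_tails d y"
  shows "y n \<notin> \<rat>"
proof
  assume "y n \<in> \<rat>"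
  moreover have False if "real q * y n = real p" "0 < q" for p q :: nat
    using that
  proof (induction q arbitrary: p n rule: less_induct)
    case (less q)
    note y = cf_tailsD[OF assms]
    have "0 < real p" using less.prems y(2)[of n] by (metis mult_pos_pos of_nat_0_less_iff)
    have "real p < real q" 
      using less.prems y(3)[of n] mult_strict_left_mono[of "y n" 1 "real q"] by simp
    have "y n * (real (d n) + y (Suc n)) = 1"
      using y(4)[of n] y(2)[of "Suc n"] by (simp add: field_simps)
    then have "real q = real p * (real (d n) + y (Suc n))"
      unfolding less.prems(1)[symmetric] mult.assoc by simp
    then have eq: "real p * y (Suc n) = real q - real (d n * p)" by (simp add: algebra_simps)
    then have "real (d n * p) < real q"
      using \<open>0 < real p\<close> y(2)[of "Suc n"] by (metis diff_gt_0_iff_gt mult_pos_pos)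
    then have "d n * p < q" by (simp only: of_nat_less_iff)
    then have "real p * y (Suc n) = real (q - d n * p)" using eq by (simp add: of_nat_diff)
    then show False
      using less.IH[of p] \<open>0 < real p\<close> \<open>real p < real q\<close> by simp
  qed
  moreover obtain p q where "q \<noteq> 0" "\<bar>y n\<bar> = real p / real q"
    using \<open>y n \<in> \<rat>\<close> by (rule Rats_abs_nat_div_natE)
  then have "real q * y n = real p" "0 < q" using cf_tailsD(2)[OF assms, of n] by auto
  ultimately show False by blast
qed

text \<open>The pair of the last two continuants \<open>(q\<^sub>n, q\<^sub>n\<^sub>-\<^sub>1)\<close> of a word of length \<open>n\<close>. The map from
  a tail to the continued fraction with prefix \<open>w\<close> is a Moebius map of determinant \<open>\<plusminus>1\<close> and
  denominator \<open>q\<^sub>n + q\<^sub>n\<^sub>-\<^sub>1 * y\<close>; this determines all distances below.\<close>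

definition denoms :: "nat list \<Rightarrow> real \<times> real" where
  "denoms w = foldl (\<lambda>(q, q') a. (real a * q + q', q)) (1, 0) w"

text \<open>The length of the interval of continued fractions with prefix \<open>w\<close>.\<close>

definition cylinder_size :: "nat list \<Rightarrow> real" where
  "cylinder_size w = 1 / (fst (denoms w) * (fst (denoms w) + snd (denoms w)))"

lemma denoms_snoc: "denoms (w @ [a]) = (real a * fst (denoms w) + snd (denoms w), fst (denoms w))"
  by (simp add: denoms_def split: prod.splits)

lemma denoms_bounds:
  assumes "\<forall>a\<in>set w. 1 \<le> a"
  shows "1 \<le> fst (denoms w) \<and> 0 \<le> snd (denoms w) \<and> snd (denoms w) \<le> fst (denoms w)"
  using assms
proof (induction w rule: rev_induct)
  case (snoc a w)
  then have "1 * fst (denoms w) \<le> real a * fst (denoms w)"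
    by (intro mult_right_mono) auto
  moreover have "1 \<le> fst (denoms w)" "0 \<le> snd (denoms w)" using snoc by auto
  ultimately have "1 \<le> real a * fst (denoms w) + snd (denoms w)"
      "fst (denoms w) \<le> real a * fst (denoms w) + snd (denoms w)" by linarith+
  then show ?case using \<open>1 \<le> fst (denoms w)\<close> by (simp add: denoms_snoc)
qed (simp add: denoms_def)

text \<open>The difference formula \<open>\<bar>M y - M z\<bar> = \<bar>y - z\<bar> / (den y * den z)\<close> of a Moebius map of
  determinant \<open>\<plusminus>1\<close>.\<close>

lemma cf_tails_diff:
  assumes "cf_tails d y" "cf_tails e z" "prefix n d = prefix n e"
  shows "\<bar>y 0 - z 0\<bar> = \<bar>y n - z n\<bar> /
     ((fst (denoms (prefix n d)) + snd (denoms (prefix n d)) * y n) *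
      (fst (denoms (prefix n d)) + snd (denoms (prefix n d)) * z n))"
  using assms(3)
proof (induction n)
  case 0
  then show ?case by (simp add: denoms_def)
next
  case (Suc n)
  define q q' where "q = fst (denoms (prefix n d))" and "q' = snd (denoms (prefix n d))"
  define Y Z a where "Y = y (Suc n)" and "Z = z (Suc n)" and "a = real (d n)"
  have "\<forall>a\<in>set (prefix n d). 1 \<le> a"
    using cf_tailsD(1)[OF assms(1)] by (auto simp: prefix_def)
  then have q: "1 \<le> q" "0 \<le> q'" using denoms_bounds unfolding q_def q'_def by blast+
  have YZ: "0 < Y" "0 < Z" "1 \<le> a"
    using cf_tailsD(2)[OF assms(1)] cf_tailsD(2)[OF assms(2)] cf_tailsD(1)[OF assms(1), of n]
    unfolding Y_def Z_def a_def by auto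
  have y: "y n = 1 / (a + Y)" and z: "z n = 1 / (a + Z)"
    using cf_tailsD(4)[OF assms(1), of n] cf_tailsD(4)[OF assms(2), of n] Suc.prems
    by (auto simp: a_def Y_def Z_def prefix_eq_iff)
  have pre: "prefix n d = prefix n e" using Suc.prems by (simp add: prefix_Suc)
  have num: "y n - z n = (Z - Y) / ((a + Y) * (a + Z))"
    unfolding y z using YZ by (simp add: divide_simps)
  have den: "(q + q' * y n) * (a + Y) = (a * q + q') + q * Y"
      "(q + q' * z n) * (a + Z) = (a * q + q') + q * Z"
    unfolding y z using YZ by (simp_all add: field_simps)
  have "\<bar>y 0 - z 0\<bar> = \<bar>y n - z n\<bar> / ((q + q' * y n) * (q + q' * z n))"
    using Suc.IH pre by (simp add: q_def q'_def)
  also have "\<dots> = \<bar>Y - Z\<bar> / (((q + q' * y n) * (a + Y)) * ((q + q' * z n) * (a + Z)))"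
    unfolding num abs_divide using YZ by (simp add: abs_mult abs_minus_commute mult_ac)
  finally show ?case
    unfolding den by (simp add: prefix_Suc denoms_snoc Y_def Z_def a_def q_def q'_def)
qed

lemma cylinder_size_pos:
  assumes "\<forall>a\<in>set w. 1 \<le> a"
  shows "0 < cylinder_size w" "cylinder_size w \<le> 1"
  using denoms_bounds[OF assms] mult_mono[of 1 "fst (denoms w)" 1 "fst (denoms w) + snd (denoms w)"]
  by (auto simp: cylinder_size_def divide_le_eq)

lemma cylinder_size_le_dist:
  assumes "cf_tails d y" "cf_tails e z" "prefix n d = prefix n e"
  shows "\<bar>y n - z n\<bar> * cylinder_size (prefix n d) \<le> 2 * \<bar>y 0 - z 0\<bar>"
proof -
  define q q' where "q = fst (denoms (prefix n d))" and "q' = snd (denoms (prefix n d))"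
  have "\<forall>a\<in>set (prefix n d). 1 \<le> a"
    using cf_tailsD(1)[OF assms(1)] by (auto simp: prefix_def)
  then have q: "1 \<le> q" "0 \<le> q'" "q' \<le> q" using denoms_bounds unfolding q_def q'_def by blast+
  have yz: "0 < y n" "y n < 1" "0 < z n" "z n < 1"
    using cf_tailsD[OF assms(1)] cf_tailsD[OF assms(2)] by blast+
  have "(q + q' * y n) * (q + q' * z n) \<le> (q + q') * (2 * q)"
    using q yz by (intro mult_mono) (auto intro: add_mono mult_left_le order_trans[OF mult_left_le])
  then have "\<bar>y n - z n\<bar> / ((q + q') * (2 * q)) \<le> \<bar>y n - z n\<bar> / ((q + q' * y n) * (q + q' * z n))"
    using q yz by (intro divide_left_mono mult_pos_pos add_pos_nonneg mult_nonneg_nonneg) auto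
  also have "\<dots> = \<bar>y 0 - z 0\<bar>"
    using cf_tails_diff[OF assms] by (simp add: q_def q'_def)
  finally have "\<bar>y n - z n\<bar> / (q * (q + q')) / 2 \<le> \<bar>y 0 - z 0\<bar>"
    by (simp add: mult_ac)
  moreover have "u \<le> 2 * v" if "u / 2 \<le> v" for u v :: real using that by simp
  ultimately have "\<bar>y n - z n\<bar> / (q * (q + q')) \<le> 2 * \<bar>y 0 - z 0\<bar>" by blast
  then show ?thesis by (simp add: cylinder_size_def flip: q_def q'_def)
qed

text \<open>A prescribed digit shrinks the cylinder at most polynomially in the digit.\<close>

lemma cylinder_size_snoc_ge:
  assumes "\<forall>a\<in>set w. 1 \<le> a" "1 \<le> c"
  shows "cylinder_size w \<le> (real c + 1)^2 * cylinder_size (w @ [c])"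
proof -
  define q q' where "q = fst (denoms w)" and "q' = snd (denoms w)"
  have q: "1 \<le> q" "0 \<le> q'" "q' \<le> q" using denoms_bounds[OF assms(1)] unfolding q_def q'_def by blast+
  have c: "1 \<le> real c" using assms by simp
  have "(c * q + q') * ((c * q + q') + q) \<le> ((c + 1) * q) * ((c + 1) * (q + q'))"
    using q c by (intro mult_mono) (auto simp: algebra_simps)
  moreover have "0 < (c * q + q') * ((c * q + q') + q)" 
    using q c by (intro mult_pos_pos add_pos_nonneg add_nonneg_pos) auto
  moreover have "0 < q * (q + q')" using q by simp
  ultimately have "1 / (q * (q + q')) \<le> (real c + 1)^2 * (1 / ((c * q + q') * ((c * q + q') + q)))"
    by (simp add: divide_simps power2_eq_square) (simp add: algebra_simps)
  then show ?thesis
    by (simp add: cylinder_size_def denoms_snoc q_def q'_def)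
qed

text \<open>The source of dimension close to 1. The children with digit at most \<open>N\<close> fill all but a
  proportion \<open>2 / (N + 1)\<close> of their parent, and each has at most half its length. A power
  \<open>s < 1\<close> favours small pieces, so passing to the children gains a factor \<open>2 powr (1 - s)\<close>,
  which beats the missing proportion once \<open>N\<close> is large.\<close>

lemma cylinder_size_powr_le_sum_children:
  assumes "\<forall>a\<in>set w. 1 \<le> a" "0 \<le> s" "s < 1"
  shows "2 powr (1 - s) * (1 - 2 / (real N + 1)) * cylinder_size w powr s
     \<le> (\<Sum>a\<in>{1..N}. cylinder_size (w @ [a]) powr s)"
proof -
  define q q' where "q = fst (denoms w)" and "q' = snd (denoms w)"
  have q: "1 \<le> q" "0 \<le> q'" "q' \<le> q" using denoms_bounds[OF assms(1)] unfolding q_def q'_def by blast+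
  define P where "P = cylinder_size w"
  define p where "p a = cylinder_size (w @ [a])" for a
  have P: "P = 1 / (q * (q + q'))"
    by (simp add: P_def cylinder_size_def q_def q'_def)
  have p: "p a = 1 / ((a * q + q') * ((a * q + q') + q))" for a
    by (simp add: p_def cylinder_size_def denoms_snoc q_def q'_def)
  have pos: "0 < a * q + q'" if "1 \<le> a" for a :: nat
    using q that by (intro add_pos_nonneg) auto
  have "P > 0" using q by (simp add: P)
  have p_pos: "0 < p a" if "1 \<le> a" for a
    using pos[OF that] q by (auto simp: p intro: add_pos_pos)
  have p_le: "p a \<le> P / 2" if "1 \<le> a" for a
  proof -
    have "1 * q \<le> real a * q" using that q by (intro mult_right_mono) auto
    then have "q \<le> a * q" by simp
    then have "(q + q') * (2 * q) \<le> (a * q + q') * ((a * q + q') + q)"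
      using q by (intro mult_mono; linarith)
    then show ?thesis using q pos[OF that] unfolding P p
      by (simp add: divide_simps add_pos_pos) (simp add: algebra_simps)
  qed
  have telescope: "(\<Sum>a\<in>{1..N}. p a) = (1 / q) * (1 / (q + q') - 1 / (real (N + 1) * q + q'))"
  proof (induction N)
    case (Suc N)
    have "p (Suc N) = (1 / q) * (1 / (real (N + 1) * q + q') - 1 / (real (N + 2) * q + q'))"
      using pos[of "N + 1"] pos[of "N + 2"] q unfolding p
      by (simp add: divide_simps) (simp add: algebra_simps)
    then show ?case using Suc by (simp add: algebra_simps)
  qed simp
  have "2 / (real N + 1) \<ge> (q + q') / (real (N + 1) * q + q')"
  proof -
    have "0 \<le> (real N + 1) * (q - q')" using q by simp
    then have "(q + q') * (real N + 1) \<le> 2 * (real (N + 1) * q + q')" using q by (simp add: algebra_simps)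
    then show ?thesis using pos[of "N + 1"] by (simp add: divide_simps)
  qed
  then have "P * (1 - 2 / (real N + 1)) \<le> P * (1 - (q + q') / (real (N + 1) * q + q'))"
    using \<open>P > 0\<close> by (intro mult_left_mono) auto
  also have "\<dots> = (\<Sum>a\<in>{1..N}. p a)"
    unfolding telescope P using q pos[of "N + 1"] by (simp add: divide_simps)
  finally have sum_p: "P * (1 - 2 / (real N + 1)) \<le> (\<Sum>a\<in>{1..N}. p a)" .
  have "2 powr (1 - s) * (1 - 2 / (real N + 1)) * P powr s
      = (P / 2) powr (s - 1) * (P * (1 - 2 / (real N + 1)))"
    using \<open>P > 0\<close> by (simp add: powr_divide powr_diff)
  also have "\<dots> \<le> (P / 2) powr (s - 1) * (\<Sum>a\<in>{1..N}. p a)"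
    using sum_p by (intro mult_left_mono) auto
  also have "\<dots> = (\<Sum>a\<in>{1..N}. (P / 2) powr (s - 1) * p a)"
    by (rule sum_distrib_left)
  also have "\<dots> \<le> (\<Sum>a\<in>{1..N}. p a powr s)"
  proof (rule sum_mono)
    fix a assume "a \<in> {1..N}"
    then have "0 < p a" "p a \<le> P / 2" using p_pos p_le by auto
    then have "(P / 2) powr (s - 1) * p a \<le> p a powr (s - 1) * p a"
      using assms by (intro mult_right_mono powr_mono2') auto
    also have "\<dots> = p a powr s" using \<open>0 < p a\<close> by (simp add: powr_diff)
    finally show "(P / 2) powr (s - 1) * p a \<le> p a powr s" .
  qed
  finally show ?thesis unfolding P_def p_def .
qed

section \<open>The Renyi map along blocks\<close>

lemma birkhoff_sum_add:
  "birkhoff_sum (m + n) \<psi> x = birkhoff_sum m \<psi> x + birkhoff_sum n \<psi> ((renyi ^^ m) x)"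
  by (induction n) (simp_all add: birkhoff_sum_def funpow_add ac_simps flip: funpow_swap1)

lemma birkhoff_sum_Suc:
  "birkhoff_sum (Suc n) \<psi> x = birkhoff_sum n \<psi> x + \<psi> ((renyi ^^ n) x)"
  by (simp add: birkhoff_sum_def)

lemma birkhoff_sum_0 [simp]: "birkhoff_sum 0 \<psi> x = 0"
  by (simp add: birkhoff_sum_def)

text \<open>The digit sum is the Birkhoff sum of this function.\<close>

definition first_digit :: "real \<Rightarrow> real" where
  "first_digit u = real_of_int (\<lfloor>1 / (1 - u)\<rfloor> + 1)"

text \<open>The logarithm of the derivative \<open>1 / (1 - u)\<^sup>2\<close> of the Renyi map at \<open>u\<close>.\<close>

definition log_renyi_deriv :: "real \<Rightarrow> real" where
  "log_renyi_deriv u = - 2 * ln (1 - u)"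

lemma sum_renyi_digit:
  "(\<Sum>j=1..n. real_of_int (renyi_digit j x)) = birkhoff_sum n first_digit x"
  by (induction n) (simp_all add: birkhoff_sum_Suc renyi_digit_def first_digit_def)

lemma renyi_has_derivative:
  assumes "x < 1" "renyi x \<noteq> 0"
  shows "(renyi has_field_derivative 1 / (1 - x)\<^sup>2) (at x)"
proof -
  define k where "k = \<lfloor>1 / (1 - x)\<rfloor>"
  have "of_int k \<le> 1 / (1 - x)" "1 / (1 - x) < of_int k + 1"
    unfolding k_def by linarith+
  moreover have "of_int k \<noteq> 1 / (1 - x)"
    using assms(2) unfolding renyi_def k_def by linarith
  ultimately have k: "of_int k < 1 / (1 - x)" "1 / (1 - x) < of_int k + 1" by linarith+
  have "((\<lambda>u. 1 / (1 - u)) \<longlongrightarrow> 1 / (1 - x)) (nhds x)"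
    using assms by (intro tendsto_intros filterlim_ident) auto
  note ev = order_tendstoD[OF this]
  have "\<forall>\<^sub>F u in nhds x. renyi u = 1 / (1 - u) - of_int k"
    using ev(1)[OF k(1)] ev(2)[OF k(2)]
  proof eventually_elim
    case (elim u)
    then have "\<lfloor>1 / (1 - u)\<rfloor> = k" by (intro floor_unique) auto
    then show ?case by (simp add: renyi_def)
  qed
  moreover have "((\<lambda>u. 1 / (1 - u) - of_int k) has_field_derivative 1 / (1 - x)\<^sup>2) (at x)"
    using assms by (auto intro!: derivative_eq_intros simp: power2_eq_square)
  ultimately show ?thesis by (simp add: DERIV_cong_ev)
qed

text \<open>The discontinuities in \<open>(0, 1)\<close> are exactly the points mapped to 0. An orbit in \<open>(0, 1)\<close>
  avoids them, and the chain rule applies.\<close>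

lemma ln_deriv_renyi_funpow:
  assumes orbit: "\<And>j. 0 < (renyi ^^ j) x \<and> (renyi ^^ j) x < 1"
  shows "ln \<bar>deriv (renyi ^^ n) x\<bar> = birkhoff_sum n log_renyi_deriv x"
proof -
  have "((renyi ^^ n) has_field_derivative exp (birkhoff_sum n log_renyi_deriv x)) (at x)"
  proof (induction n)
    case (Suc n)
    define u where "u = (renyi ^^ n) x"
    have u: "u < 1" "renyi u \<noteq> 0" using orbit[of n] orbit[of "Suc n"] by (auto simp: u_def)
    have "exp (log_renyi_deriv u) = 1 / (exp (ln (1 - u)))\<^sup>2"
      by (simp add: log_renyi_deriv_def exp_minus inverse_eq_divide flip: exp_double)
    then have "exp (log_renyi_deriv u) = 1 / (1 - u)\<^sup>2" using u by simp
    then have "(renyi has_field_derivative exp (log_renyi_deriv u)) (at ((renyi ^^ n) x))"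
      using renyi_has_derivative[OF u] by (simp add: u_def)
    from DERIV_chain[OF this Suc] show ?case
      by (simp add: birkhoff_sum_Suc exp_add mult.commute comp_def flip: u_def)
  qed (simp add: DERIV_ident id_def)
  then show ?thesis by (simp add: DERIV_imp_deriv)
qed

text \<open>Near the neutral fixed point 0 the map acts on \<open>1 / u\<close> by subtracting 1.\<close>

lemma floor_eq_1_of_gt_2:
  fixes t :: real
  assumes "2 < t"
  shows "1 / (1 - 1 / t) = 1 + 1 / (t - 1)" "\<lfloor>1 / (1 - 1 / t)\<rfloor> = 1"
proof -
  show eq: "1 / (1 - 1 / t) = 1 + 1 / (t - 1)" using assms by (simp add: field_simps)
  have "0 < 1 / (t - 1)" "1 / (t - 1) < 1" using assms by (auto simp: field_simps)
  then show "\<lfloor>1 / (1 - 1 / t)\<rfloor> = 1" unfolding eq by (intro floor_unique) auto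
qed

text \<open>The point \<open>z = [0; a, b, \<dots>]\<close>, where \<open>y\<close> is the continued fraction after removing the first
  two digits. Since the Renyi map subtracts 1 from the reciprocal as long as the orbit is
  below \<open>1 / 2\<close>, the orbit spends \<open>a - 1\<close> steps there, then makes one step from above \<open>1 / 2\<close> whose
  digit is \<open>b + 2\<close>, and lands in \<open>y\<close> after \<open>a\<close> steps in total.\<close>

locale renyi_block =
  fixes a b :: nat and y z :: real
  assumes a: "1 \<le> a" and b: "1 \<le> b" and y: "0 < y" "y < 1"
    and z: "z = 1 / (real a + 1 / (real b + y))"
begin

lemma remainder: "0 < 1 / (real b + y)" "1 / (real b + y) < 1"
  using b y by (auto simp: divide_less_eq)

lemma orbit: "j < a \<Longrightarrow> (renyi ^^ j) z = 1 / ((real a - real j) + 1 / (real b + y))"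
proof (induction j)
  case 0
  then show ?case using z by simp
next
  case (Suc j)
  define t where "t = (real a - real j) + 1 / (real b + y)"
  have "real j + 2 \<le> real a" using Suc.prems by linarith
  then have "2 < t" using remainder unfolding t_def by linarith
  have "renyi (1 / t) = 1 / (t - 1)"
    unfolding renyi_def floor_eq_1_of_gt_2(2)[OF \<open>2 < t\<close>]
    unfolding floor_eq_1_of_gt_2(1)[OF \<open>2 < t\<close>] by simp
  moreover have "t - 1 = (real a - real (Suc j)) + 1 / (real b + y)"
    by (simp add: t_def)
  moreover have "(renyi ^^ j) z = 1 / t" using Suc by (simp add: t_def)
  ultimately show ?case by simp
qed

lemma digit_before_end:
  assumes "Suc j < a"
  shows "first_digit ((renyi ^^ j) z) = 2"
proof -
  define t where "t = (real a - real j) + 1 / (real b + y)"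
  have "real j + 2 \<le> real a" using assms by linarith
  then have "2 < t" using remainder unfolding t_def by linarith
  have "\<lfloor>1 / (1 - 1 / t)\<rfloor> = 1" by (rule floor_eq_1_of_gt_2) fact
  moreover have "(renyi ^^ j) z = 1 / t" using orbit[of j] assms by (simp add: t_def)
  ultimately show ?thesis by (simp add: first_digit_def)
qed

lemma end_inverse: "1 / (1 - (renyi ^^ (a - 1)) z) = real (b + 1) + y"
proof -
  have "(renyi ^^ (a - 1)) z = 1 / (1 + 1 / (real b + y))"
    using orbit[of "a - 1"] a by (simp add: of_nat_diff)
  moreover have "0 < real b + y" using b y by simp
  then have "1 / (1 - 1 / (1 + 1 / (real b + y))) = real (b + 1) + y"
    by (simp add: field_simps)
  ultimately show ?thesis by simp
qed

lemma end_floor: "\<lfloor>1 / (1 - (renyi ^^ (a - 1)) z)\<rfloor> = int b + 1"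
  unfolding end_inverse using y by (intro floor_unique) auto

lemma renyi_funpow_block: "(renyi ^^ a) z = y"
proof -
  have "(renyi ^^ Suc (a - 1)) z = y"
    unfolding funpow.simps comp_def renyi_def[of "(renyi ^^ (a - 1)) z"] end_floor
    unfolding end_inverse by simp
  then show ?thesis using a by simp
qed

lemma z_bounds: "0 < z" "z < 1"
proof -
  have "1 < real a + 1 / (real b + y)" using remainder a by linarith
  then show "0 < z" "z < 1" by (auto simp: z divide_less_eq)
qed

lemma orbit_bounds:
  assumes "j \<le> a"
  shows "0 < (renyi ^^ j) z" "(renyi ^^ j) z < 1"
proof -
  have "0 < (renyi ^^ j) z \<and> (renyi ^^ j) z < 1"
  proof (cases "j = a")
    case True
    then show ?thesis using renyi_funpow_block y by simp
  next
    case False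
    then have "j < a" using assms by simp
    then have "real j + 1 \<le> real a" by linarith
    then have "1 < (real a - real j) + 1 / (real b + y)" using remainder by linarith
    then show ?thesis using orbit[OF \<open>j < a\<close>] by (auto simp: divide_less_eq)
  qed
  then show "0 < (renyi ^^ j) z" "(renyi ^^ j) z < 1" by auto
qed

lemma birkhoff_sum_digit_before_end: "j < a \<Longrightarrow> birkhoff_sum j first_digit z = 2 * real j"
  by (induction j) (auto simp: birkhoff_sum_Suc digit_before_end)

lemma birkhoff_sum_digit: "birkhoff_sum a first_digit z = 2 * real a + real b"
proof -
  have "birkhoff_sum (Suc (a - 1)) first_digit z = 2 * real (a - 1) + (real b + 2)"
    unfolding birkhoff_sum_Suc using a end_floor
    by (subst birkhoff_sum_digit_before_end) (auto simp: first_digit_def)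
  then show ?thesis using a by (simp add: of_nat_diff)
qed

text \<open>Along the block \<open>1 - (renyi ^^ j) z\<close> is a quotient of consecutive terms of an arithmetic
  progression, so the sum telescopes.\<close>

lemma birkhoff_sum_log_renyi_deriv:
  "j \<le> a \<Longrightarrow> birkhoff_sum j log_renyi_deriv z =
     2 * (ln (real a + 1 / (real b + y)) - ln ((real a - real j) + 1 / (real b + y)))"
proof (induction j)
  case (Suc j)
  define t where "t = (real a - real (Suc j)) + 1 / (real b + y)"
  have "0 < t" using remainder Suc.prems unfolding t_def by linarith
  have t: "(real a - real j) + 1 / (real b + y) = t + 1"
    by (simp add: t_def)
  have "1 - (renyi ^^ j) z = t / (t + 1)"
    using orbit[of j] Suc.prems \<open>0 < t\<close> unfolding t by (simp add: field_simps)
  then have "log_renyi_deriv ((renyi ^^ j) z) = 2 * (ln (t + 1) - ln t)"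
    using \<open>0 < t\<close> by (simp add: log_renyi_deriv_def ln_div)
  moreover have "birkhoff_sum j log_renyi_deriv z = 2 * (ln (real a + 1 / (real b + y)) - ln (t + 1))"
    using Suc t by simp
  ultimately show ?case unfolding birkhoff_sum_Suc t_def[symmetric] by simp
qed simp

text \<open>The bound is in terms of the number \<open>j\<close> of steps made rather than the block length, so that
  it can be compared with \<open>j\<close> even in the middle of a long block.\<close>

lemma birkhoff_sum_log_renyi_deriv_le:
  assumes "j \<le> a"
  shows "0 \<le> birkhoff_sum j log_renyi_deriv z"
    "birkhoff_sum j log_renyi_deriv z \<le> 2 * ln (real j + 1) + (if j = a then 2 * ln (real b + 1) else 0)"
proof -
  define r where "r = 1 / (real b + y)"
  have r: "0 < r" "r < 1" using remainder by (simp_all add: r_def)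
  have eq: "birkhoff_sum j log_renyi_deriv z = 2 * (ln (real a + r) - ln ((real a - real j) + r))"
    using birkhoff_sum_log_renyi_deriv[OF assms] by (simp add: r_def)
  have "ln ((real a - real j) + r) \<le> ln (real a + r)"
    using r assms by (subst ln_le_cancel_iff) (auto intro: add_nonneg_pos)
  then show "0 \<le> birkhoff_sum j log_renyi_deriv z" by (simp add: eq)
  show "birkhoff_sum j log_renyi_deriv z \<le> 2 * ln (real j + 1) + (if j = a then 2 * ln (real b + 1) else 0)"
  proof (cases "j = a")
    case True
    have "ln (real a + r) \<le> ln (real a + 1)" using r by (subst ln_le_cancel_iff) (auto intro: add_nonneg_pos)
    moreover have "- ln r \<le> ln (real b + 1)"
      using b y by (simp add: r_def ln_div)
    moreover have "birkhoff_sum j log_renyi_deriv z = 2 * (ln (real a + r) - ln r)"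
      unfolding eq using True by simp
    ultimately show ?thesis using True by simp
  next
    case False
    have "real j + 1 \<le> real a" using False assms by linarith
    then have *: "0 \<le> real j * ((real a - real j) - 1) + real j * r" using r by simp
    have "real a + r \<le> (real j + 1) * ((real a - real j) + r)"
      using * by (simp add: algebra_simps)
    then have "ln (real a + r) \<le> ln ((real j + 1) * ((real a - real j) + r))"
      using r by (subst ln_le_cancel_iff) (auto intro!: add_nonneg_pos mult_pos_pos)
    also have "\<dots> = ln (real j + 1) + ln ((real a - real j) + r)"
      using r assms by (subst ln_mult_pos) (auto intro!: add_nonneg_pos)
    finally show ?thesis using False by (simp add: eq)
  qed
qed

lemma in_cylinder_of_ones:
  assumes "j < a"
  shows "z \<in> renyi_cylinder (replicate j 1)"
proof -
  have "(renyi ^^ i) z \<in> renyi_cell 1" if "i < j" for i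
  proof -
    have "real i + 2 \<le> real a" using that assms by linarith
    then have "2 < (real a - real i) + 1 / (real b + y)" using remainder by linarith
    moreover have "0 \<le> 1 / t \<and> 1 / t < 1 / 2" if "2 < t" for t :: real
      using that by (simp add: divide_less_eq)
    ultimately show ?thesis using orbit[of i] that assms by (simp add: renyi_cell_def)
  qed
  then show ?thesis using z_bounds by (simp add: renyi_cylinder_def)
qed

end

lemma renyi_funpow_0 [simp]: "(renyi ^^ n) 0 = 0"
  by (induction n) (simp_all add: renyi_def)

lemma birkhoff_sum_at_0: "birkhoff_sum n \<psi> 0 = real n * \<psi> 0"
  by (simp add: birkhoff_sum_def)

lemma zero_in_cylinder_of_ones: "0 \<in> renyi_cylinder (replicate j 1)"
  by (simp add: renyi_cylinder_def renyi_cell_def)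

lemma birkhoff_sum_diff_le_distortion:
  assumes "w \<in> pos_words n" "x \<in> renyi_cylinder w" "y \<in> renyi_cylinder w"
  shows "ereal \<bar>birkhoff_sum n \<phi> x - birkhoff_sum n \<phi> y\<bar> \<le> distortion n \<phi>"
proof -
  have "ereal (birkhoff_sum n \<phi> x - birkhoff_sum n \<phi> y) \<le> distortion n \<phi>"
    "ereal (birkhoff_sum n \<phi> y - birkhoff_sum n \<phi> x) \<le> distortion n \<phi>"
    unfolding distortion_def using assms
    by (blast intro: SUP_upper2 order_refl)+
  then show ?thesis by (auto simp: abs_if)
qed

text \<open>Both \<open>z\<close> and the fixed point 0 lie in the cylinder of the word \<open>1 \<dots> 1\<close>, and the Birkhoff sum
  at 0 is \<open>j * \<phi> 0\<close>. So the distortion controls the difference: it is at most \<open>\<epsilon> * j\<close> for long words,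
  and bounded for the finitely many short ones.\<close>

lemma mild_distortion_on_ones:
  assumes mild: "\<phi> \<in> mild_distortion" and bdd: "\<And>x. \<lbrakk>0 \<le> x; x < 1\<rbrakk> \<Longrightarrow> \<bar>\<phi> x\<bar> \<le> B"
    and "0 < \<epsilon>"
  shows "\<exists>C. \<forall>j z. z \<in> renyi_cylinder (replicate j 1) \<longrightarrow>
    \<bar>birkhoff_sum j \<phi> z - real j * \<phi> 0\<bar> \<le> \<epsilon> * real j + C"
proof -
  have "(\<lambda>n. distortion n \<phi> / ereal (real n)) \<longlonglongrightarrow> 0"
    using mild by (simp add: mild_distortion_def)
  then have "\<forall>\<^sub>F n in sequentially. distortion n \<phi> / ereal (real n) < ereal \<epsilon>"
    using \<open>0 < \<epsilon>\<close> by (intro order_tendstoD) auto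
  then obtain n0 where n0: "\<And>n. n0 \<le> n \<Longrightarrow> distortion n \<phi> / ereal (real n) < ereal \<epsilon>"
    unfolding eventually_sequentially by blast
  have "0 \<le> B" using bdd[of 0] by simp
  have "\<bar>birkhoff_sum j \<phi> z - real j * \<phi> 0\<bar> \<le> \<epsilon> * real j + 2 * B * (real n0 + 1)"
    if z: "z \<in> renyi_cylinder (replicate j 1)" for j z
  proof (cases "n0 \<le> j \<and> 0 < j")
    case True
    have "replicate j 1 \<in> pos_words j" by (simp add: pos_words_def)
    then have "ereal \<bar>birkhoff_sum j \<phi> z - real j * \<phi> 0\<bar> \<le> distortion j \<phi>"
      using birkhoff_sum_diff_le_distortion[OF _ z zero_in_cylinder_of_ones]
      by (simp add: birkhoff_sum_at_0)
    also have "distortion j \<phi> < ereal (\<epsilon> * real j)"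
      using n0[of j] True by (cases "distortion j \<phi>") (auto simp: divide_less_eq)
    finally show ?thesis using \<open>0 \<le> B\<close> by (simp add: add_increasing2)
  next
    case False
    have "\<bar>birkhoff_sum j \<phi> z - real j * \<phi> 0\<bar> = \<bar>\<Sum>i<j. \<phi> ((renyi ^^ i) z) - \<phi> 0\<bar>"
      by (simp add: birkhoff_sum_def sum_subtractf)
    also have "\<dots> \<le> (\<Sum>i<j. \<bar>\<phi> ((renyi ^^ i) z) - \<phi> 0\<bar>)" by (rule sum_abs)
    also have "\<dots> \<le> (\<Sum>i<j. 2 * B)"
    proof (rule sum_mono)
      fix i assume "i \<in> {..<j}"
      then have "(renyi ^^ i) z \<in> renyi_cell 1" using z by (simp add: renyi_cylinder_def)
      then have "\<bar>\<phi> ((renyi ^^ i) z)\<bar> \<le> B" by (intro bdd) (auto simp: renyi_cell_def)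
      then show "\<bar>\<phi> ((renyi ^^ i) z) - \<phi> 0\<bar> \<le> 2 * B" using bdd[of 0] by linarith
    qed
    also have "\<dots> = 2 * B * real j" by simp
    also have "\<dots> \<le> 2 * B * (real n0 + 1)"
      using False \<open>0 \<le> B\<close> by (intro mult_left_mono) auto
    finally show ?thesis using \<open>0 < \<epsilon>\<close> by (simp add: add_increasing)
  qed
  then show ?thesis by blast
qed

section \<open>Averages along orbits made of long blocks\<close>

lemma ln_sublinear:
  assumes "0 < \<epsilon>"
  shows "\<exists>C. \<forall>n::nat. ln (real n + 1) \<le> \<epsilon> * real n + C"
proof (intro exI allI)
  fix n :: nat
  have "ln (\<epsilon> * (real n + 1)) \<le> \<epsilon> * (real n + 1) - 1"
    using assms by (intro ln_le_minus_one) auto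
  then show "ln (real n + 1) \<le> \<epsilon> * real n + (\<epsilon> - 1 - ln \<epsilon>)"
    using assms by (subst (asm) ln_mult_pos) (auto simp: algebra_simps)
qed

text \<open>A point \<open>z 0\<close> with continued fraction \<open>[0; a 0, b 0, a 1, b 1, \<dots>]\<close>, viewed as a sequence of blocks.
  By \<open>rare_ends\<close>, \<open>m\<close> blocks take a time that grows faster than \<open>m\<close>; so an error
  that is bounded on each block does not affect averages.\<close>

locale renyi_blocks =
  fixes a b :: "nat \<Rightarrow> nat" and z :: "nat \<Rightarrow> real"
  assumes block: "renyi_block (a i) (b i) (z (Suc i)) (z i)"
    and rare_ends: "0 < \<epsilon> \<Longrightarrow> \<forall>\<^sub>F m in sequentially. real (Suc m) \<le> \<epsilon> * (\<Sum>i<m. real (a i))"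
begin

definition time :: "nat \<Rightarrow> nat" where
  "time m = (\<Sum>i<m. a i)"

lemma time_0 [simp]: "time 0 = 0" and time_Suc: "time (Suc m) = time m + a m"
  by (simp_all add: time_def)

lemma funpow_time: "(renyi ^^ time m) (z 0) = z m"
proof (induction m)
  case (Suc m)
  then show ?case using renyi_block.renyi_funpow_block[OF block[of m]]
    by (simp add: time_Suc funpow_add add.commute[of "time m"])
qed simp

lemma birkhoff_sum_blocks:
  "birkhoff_sum (time m + j) \<psi> (z 0) =
     (\<Sum>i<m. birkhoff_sum (a i) \<psi> (z i)) + birkhoff_sum j \<psi> (z m)"
proof -
  have "birkhoff_sum (time m) \<psi> (z 0) = (\<Sum>i<m. birkhoff_sum (a i) \<psi> (z i))"
    by (induction m) (simp_all add: time_Suc birkhoff_sum_add funpow_time)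
  then show ?thesis by (simp add: birkhoff_sum_add funpow_time)
qed

lemma time_split: "\<exists>m j. n = time m + j \<and> j < a m"
proof (induction n)
  case 0
  have "0 < a 0" using renyi_block.a[OF block[of 0]] by simp
  then show ?case by (intro exI[of _ 0]) simp
next
  case (Suc n)
  then obtain m j where "n = time m + j" "j < a m" by blast
  moreover have "0 < a (Suc m)" using renyi_block.a[OF block[of "Suc m"]] by simp
  ultimately have "Suc n = time m + Suc j \<and> Suc j < a m \<or>
      Suc n = time (Suc m) + 0 \<and> 0 < a (Suc m)"
    by (auto simp: time_Suc)
  then show ?case by blast
qed

lemma orbit_in_unit_interval: "0 < (renyi ^^ n) (z 0) \<and> (renyi ^^ n) (z 0) < 1"
proof -
  obtain m j where "n = time m + j" "j < a m" using time_split by blast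
  then show ?thesis
    using renyi_block.orbit_bounds[OF block[of m], of j]
    by (simp add: add.commute[of "time m"] funpow_add funpow_time)
qed

text \<open>The same statement in terms of an arbitrary time \<open>n\<close> instead of the end of a block;
  \<open>Suc m\<close> counts the block in progress as well.\<close>

lemma few_blocks:
  assumes "0 < \<epsilon>"
  shows "\<forall>\<^sub>F n in sequentially. \<forall>m j. n = time m + j \<longrightarrow> real (Suc m) \<le> \<epsilon> * real n"
proof -
  obtain M where M: "\<And>m. M \<le> m \<Longrightarrow> real (Suc m) \<le> \<epsilon> * real (time m)"
    using rare_ends[OF assms] by (auto simp: eventually_sequentially time_def)
  have "real (Suc m) \<le> \<epsilon> * real (time m + j)"
    if "real (Suc M) / \<epsilon> \<le> real (time m + j)" for m j
  proof (cases "M \<le> m")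
    case True
    then show ?thesis using M[of m] assms by (simp add: distrib_left add_increasing2)
  next
    case False
    then have "real (Suc m) \<le> real (Suc M)" by simp
    also have "\<dots> \<le> \<epsilon> * real (time m + j)" using that assms by (simp add: divide_le_eq mult.commute)
    finally show ?thesis .
  qed
  moreover have "\<forall>\<^sub>F n in sequentially. real (Suc M) / \<epsilon> \<le> real n"
    by real_asymp
  ultimately show ?thesis by (auto elim!: eventually_mono)
qed

text \<open>The bound is required also for incomplete blocks (\<open>j \<le> a i\<close>), because the last block before
  time \<open>n\<close> is in general unfinished and may be long.\<close>

lemma birkhoff_average_tendsto:
  assumes "\<And>\<epsilon>. 0 < \<epsilon> \<Longrightarrow> \<exists>C. \<forall>i j. j \<le> a i \<longrightarrow> \<bar>birkhoff_sum j \<psi> (z i) - real j * c\<bar> \<le> \<epsilon> * real j + C"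
  shows "(\<lambda>n. birkhoff_sum n \<psi> (z 0) / real n) \<longlonglongrightarrow> c"
proof (rule tendstoI)
  fix e :: real assume "0 < e"
  \<comment> \<open>One third of \<open>e\<close> for the errors proportional to time, one third for the block count, and
    one third to make the inequality strict.\<close>
  define \<epsilon> where "\<epsilon> = e / 3"
  have "0 < \<epsilon>" using \<open>0 < e\<close> by (simp add: \<epsilon>_def)
  from assms[OF this] obtain C where C:
    "\<And>i j. j \<le> a i \<Longrightarrow> \<bar>birkhoff_sum j \<psi> (z i) - real j * c\<bar> \<le> \<epsilon> * real j + C" by blast
  have "0 \<le> C" using C[of 0 0] by simp
  have "0 < \<epsilon> / (C + 1)" using \<open>0 < \<epsilon>\<close> \<open>0 \<le> C\<close> by simp
  from few_blocks[OF this] eventually_gt_at_top[of 0]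
  show "\<forall>\<^sub>F n in sequentially. dist (birkhoff_sum n \<psi> (z 0) / real n) c < e"
  proof eventually_elim
    case (elim n)
    obtain m j where mj: "n = time m + j" "j < a m" using time_split by blast
    have "birkhoff_sum n \<psi> (z 0) - real n * c =
        (\<Sum>i<m. birkhoff_sum (a i) \<psi> (z i) - real (a i) * c) + (birkhoff_sum j \<psi> (z m) - real j * c)"
      unfolding mj(1) birkhoff_sum_blocks
      by (simp add: time_def sum_subtractf algebra_simps sum_distrib_left)
    also have "\<bar>\<dots>\<bar> \<le> (\<Sum>i<m. \<bar>birkhoff_sum (a i) \<psi> (z i) - real (a i) * c\<bar>)
        + \<bar>birkhoff_sum j \<psi> (z m) - real j * c\<bar>"
      by (intro order_trans[OF abs_triangle_ineq] add_mono sum_abs order_refl)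
    also have "\<dots> \<le> (\<Sum>i<m. \<epsilon> * real (a i) + C) + (\<epsilon> * real j + C)"
      using mj by (intro add_mono sum_mono C) auto
    also have "\<dots> = \<epsilon> * real n + C * real (Suc m)"
      unfolding mj(1) by (simp add: time_def sum.distrib algebra_simps sum_distrib_left)
    also have "\<dots> \<le> \<epsilon> * real n + C * (\<epsilon> / (C + 1) * real n)"
      using elim(1) mj \<open>0 \<le> C\<close> by (intro add_left_mono mult_left_mono) auto
    also have "C * (\<epsilon> / (C + 1) * real n) \<le> \<epsilon> * real n"
      using \<open>0 \<le> C\<close> \<open>0 < \<epsilon>\<close> by (simp add: divide_le_eq mult_right_mono algebra_simps)
    finally have "\<bar>birkhoff_sum n \<psi> (z 0) - real n * c\<bar> \<le> 2 / 3 * (e * real n)"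
      by (simp add: \<epsilon>_def)
    moreover have "0 < e * real n" using elim(2) \<open>0 < e\<close> by simp
    ultimately have "\<bar>birkhoff_sum n \<psi> (z 0) - real n * c\<bar> < e * real n" by linarith
    moreover have "birkhoff_sum n \<psi> (z 0) / real n - c = (birkhoff_sum n \<psi> (z 0) - real n * c) / real n"
      using elim(2) by (simp add: field_simps)
    ultimately show ?case
      using elim(2) by (simp add: dist_real_def divide_less_eq)
  qed
qed

text \<open>Only the last step of a block leaves the cylinder of ones; there boundedness suffices.\<close>

lemma mild_average_tendsto:
  assumes mild: "\<phi> \<in> mild_distortion" and "bounded (\<phi> ` {0..<1})"
  shows "(\<lambda>n. birkhoff_sum n \<phi> (z 0) / real n) \<longlonglongrightarrow> \<phi> 0"
proof (rule birkhoff_average_tendsto)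
  fix \<epsilon> :: real assume "0 < \<epsilon>"
  obtain B where B: "\<And>x. \<lbrakk>0 \<le> x; x < 1\<rbrakk> \<Longrightarrow> \<bar>\<phi> x\<bar> \<le> B"
    using assms(2) unfolding bounded_iff by fastforce
  obtain C where C: "\<And>j x. x \<in> renyi_cylinder (replicate j 1) \<Longrightarrow>
      \<bar>birkhoff_sum j \<phi> x - real j * \<phi> 0\<bar> \<le> \<epsilon> * real j + C"
    using mild_distortion_on_ones[OF mild _ \<open>0 < \<epsilon>\<close>, of B] B by blast
  have "\<bar>birkhoff_sum j \<phi> (z i) - real j * \<phi> 0\<bar> \<le> \<epsilon> * real j + (C + 2 * B)" if "j \<le> a i" for i j
  proof -
    interpret renyi_block "a i" "b i" "z (Suc i)" "z i" by (rule block)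
    show ?thesis
    proof (cases "j < a i")
      case True
      then show ?thesis using C[OF in_cylinder_of_ones] B[of 0] by fastforce
    next
      case False
      then obtain k where k: "j = Suc k" "k < a i" using a \<open>j \<le> a i\<close> by (cases j) auto
      have "\<bar>birkhoff_sum k \<phi> (z i) - real k * \<phi> 0\<bar> \<le> \<epsilon> * real k + C"
        using C[OF in_cylinder_of_ones] k by blast
      moreover have "\<bar>\<phi> ((renyi ^^ k) (z i))\<bar> \<le> B" "\<bar>\<phi> 0\<bar> \<le> B"
        using orbit_bounds[of k] k by (auto intro!: B)
      ultimately show ?thesis using \<open>0 < \<epsilon>\<close>
        unfolding k birkhoff_sum_Suc by (simp add: algebra_simps)
    qed
  qed
  then show "\<exists>C. \<forall>i j. j \<le> a i \<longrightarrow>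
      \<bar>birkhoff_sum j \<phi> (z i) - real j * \<phi> 0\<bar> \<le> \<epsilon> * real j + C" by blast
qed

text \<open>A block contributes \<open>O (ln a + ln b)\<close>. If \<open>b\<close> is polynomially bounded in \<open>a\<close>, this is
  sublinear in the duration \<open>a\<close> of the block.\<close>

lemma log_deriv_average_tendsto:
  assumes K: "\<And>i. real (b i) + 1 \<le> K * (real (a i) + 1)\<^sup>2"
  shows "(\<lambda>n. ln \<bar>deriv (renyi ^^ n) (z 0)\<bar> / real n) \<longlonglongrightarrow> 0"
proof -
  have "(\<lambda>n. birkhoff_sum n log_renyi_deriv (z 0) / real n) \<longlonglongrightarrow> 0"
  proof (rule birkhoff_average_tendsto)
    fix \<epsilon> :: real assume "0 < \<epsilon>"
    then have "0 < \<epsilon> / 6" by simp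
    from ln_sublinear[OF this] obtain C where
      C: "\<And>n::nat. ln (real n + 1) \<le> \<epsilon> / 6 * real n + C" by blast
    have "0 < K" using order_less_le_trans[OF _ K[of 0], of 0] zero_less_mult_pos2[of K] by simp
    have "\<bar>birkhoff_sum j log_renyi_deriv (z i) - real j * 0\<bar> \<le> \<epsilon> * real j + (6 * C + 2 * \<bar>ln K\<bar>)"
      if "j \<le> a i" for i j
    proof -
      interpret renyi_block "a i" "b i" "z (Suc i)" "z i" by (rule block)
      have "ln (real (b i) + 1) \<le> ln (K * (real (a i) + 1)\<^sup>2)"
        using K[of i] by (intro ln_mono) auto
      also have "\<dots> = ln K + 2 * ln (real (a i) + 1)"
        using \<open>0 < K\<close> by (simp add: ln_mult_pos ln_realpow)
      finally have lb: "ln (real (b i) + 1) \<le> ln K + 2 * ln (real (a i) + 1)" .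
      have "birkhoff_sum j log_renyi_deriv (z i) \<le> 6 * ln (real j + 1) + 2 * \<bar>ln K\<bar>"
      proof (cases "j = a i")
        case True
        have "birkhoff_sum j log_renyi_deriv (z i) \<le> 2 * ln (real (a i) + 1) + 2 * ln (real (b i) + 1)"
          using birkhoff_sum_log_renyi_deriv_le(2)[OF that] True by simp
        then show ?thesis using lb unfolding True by linarith
      next
        case False
        have "birkhoff_sum j log_renyi_deriv (z i) \<le> 2 * ln (real j + 1)"
          using birkhoff_sum_log_renyi_deriv_le(2)[OF that] False by simp
        moreover have "0 \<le> ln (real j + 1)" by simp
        ultimately show ?thesis by linarith
      qed
      then show ?thesis using birkhoff_sum_log_renyi_deriv_le(1)[OF that] C[of j] by simp
    qed
    then show "\<exists>C. \<forall>i j. j \<le> a i \<longrightarrow>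
      \<bar>birkhoff_sum j log_renyi_deriv (z i) - real j * 0\<bar> \<le> \<epsilon> * real j + C" by blast
  qed
  then show ?thesis using ln_deriv_renyi_funpow[OF orbit_in_unit_interval] by simp
qed

text \<open>Every digit contributes 2, and each completed block an excess equal to its \<open>b i\<close>.\<close>

lemma digit_sum:
  assumes "j < a m"
  shows "(\<Sum>i=1..time m + j. real_of_int (renyi_digit i (z 0))) =
    2 * real (time m + j) + (\<Sum>i<m. real (b i))"
proof -
  have "birkhoff_sum (a i) first_digit (z i) = 2 * real (a i) + real (b i)" for i
    by (rule renyi_block.birkhoff_sum_digit[OF block])
  moreover have "birkhoff_sum j first_digit (z m) = 2 * real j"
    by (rule renyi_block.birkhoff_sum_digit_before_end[OF block assms])
  ultimately show ?thesis
    unfolding sum_renyi_digit birkhoff_sum_blocks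
    by (simp add: time_def sum.distrib sum_distrib_left)
qed

text \<open>If \<open>b i\<close> is \<open>\<beta> * a i\<close> up to a bounded error, the excess after \<open>m\<close> blocks is
  \<open>\<beta>\<close> times the elapsed time up to \<open>O(m)\<close>. The unfinished block has length \<open>O(m)\<close> too, by the
  linear bound on \<open>a i\<close>.\<close>

lemma digit_average_tendsto:
  assumes K: "\<And>i. real (a i) \<le> K * real (Suc i)" and "0 \<le> \<beta>"
    and D: "\<And>i. \<bar>real (b i) - \<beta> * real (a i)\<bar> \<le> D"
  shows "(\<lambda>n. (\<Sum>i=1..n. real_of_int (renyi_digit i (z 0))) / real n) \<longlonglongrightarrow> 2 + \<beta>"
proof (rule tendstoI)
  fix e :: real assume "0 < e"
  have "0 \<le> D" using D[of 0] by linarith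
  have "0 \<le> K" using K[of 0] by (simp add: order_trans[OF of_nat_0_le_iff])
  define Q where "Q = D + \<beta> * K + 1"
  have "0 < Q" using \<open>0 \<le> D\<close> \<open>0 \<le> K\<close> \<open>0 \<le> \<beta>\<close> by (simp add: Q_def add_nonneg_pos)
  then have "0 < e / (2 * Q)" using \<open>0 < e\<close> by simp
  from few_blocks[OF this] eventually_gt_at_top[of 0]
  show "\<forall>\<^sub>F n in sequentially.
      dist ((\<Sum>i=1..n. real_of_int (renyi_digit i (z 0))) / real n) (2 + \<beta>) < e"
  proof eventually_elim
    case (elim n)
    obtain m j where mj: "n = time m + j" "j < a m" using time_split by blast
    define S where "S = (\<Sum>i=1..n. real_of_int (renyi_digit i (z 0)))"
    have S: "S - (2 + \<beta>) * real n = (\<Sum>i<m. real (b i) - \<beta> * real (a i)) - \<beta> * real j"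
    proof -
      have "real (time m) = (\<Sum>i<m. real (a i))" by (simp add: time_def)
      then show ?thesis
        unfolding S_def mj(1) digit_sum[OF mj(2)] sum_subtractf sum_distrib_left[symmetric]
        by (simp add: algebra_simps)
    qed
    have "\<bar>\<Sum>i<m. real (b i) - \<beta> * real (a i)\<bar> \<le> (\<Sum>i<m. D)"
      by (intro order_trans[OF sum_abs] sum_mono D)
    moreover have "\<beta> * real j \<le> \<beta> * (K * real (Suc m))"
      using mj(2) K[of m] \<open>0 \<le> \<beta>\<close> by (intro mult_left_mono) auto
    moreover have "0 \<le> \<beta> * real j" using \<open>0 \<le> \<beta>\<close> by simp
    ultimately have "\<bar>S - (2 + \<beta>) * real n\<bar> \<le> D * real m + \<beta> * (K * real (Suc m))"
      unfolding S by (simp add: mult.commute[of D])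
    also have "\<dots> \<le> Q * real (Suc m)"
      using \<open>0 \<le> D\<close> by (simp add: Q_def algebra_simps)
    also have "\<dots> \<le> Q * (e / (2 * Q) * real n)"
      using elim(1) mj(1) \<open>0 < Q\<close> by (intro mult_left_mono) auto
    also have "\<dots> < e * real n"
      using \<open>0 < Q\<close> \<open>0 < e\<close> elim(2) by simp
    finally have "\<bar>S - (2 + \<beta>) * real n\<bar> < e * real n" .
    moreover have "S / real n - (2 + \<beta>) = (S - (2 + \<beta>) * real n) / real n"
      using elim(2) by (simp add: field_simps)
    ultimately show ?case
      unfolding S_def[symmetric] dist_real_def using elim(2) by (simp add: divide_less_eq)
  qed
qed

text \<open>The same comparison with every slope \<open>R\<close>, as a lower bound.\<close>

lemma digit_average_tendsto_infinity:
  assumes K: "\<And>i. real (a i) \<le> K * real (Suc i)"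
    and D: "\<And>R. 0 \<le> R \<Longrightarrow> \<exists>D. \<forall>i. R * real (a i) - D \<le> real (b i)"
  shows "(\<lambda>n. ereal ((\<Sum>i=1..n. real_of_int (renyi_digit i (z 0))) / real n)) \<longlonglongrightarrow> \<infinity>"
proof (rule tendsto_PInfty_eq_at_top[THEN iffD2], unfold filterlim_at_top, intro allI)
  fix R0 :: real
  define R where "R = max R0 0 + 1"
  have "0 \<le> R" "R0 + 1 \<le> R" by (auto simp: R_def)
  obtain D where D: "\<And>i. R * real (a i) - D \<le> real (b i)" using D[OF \<open>0 \<le> R\<close>] by blast
  have "0 \<le> K" using K[of 0] by (simp add: order_trans[OF of_nat_0_le_iff])
  define Q where "Q = \<bar>D\<bar> + R * K + 1"
  have "0 < Q" using \<open>0 \<le> K\<close> \<open>0 \<le> R\<close> by (simp add: Q_def add_nonneg_pos)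
  then have "0 < 1 / Q" by simp
  from few_blocks[OF this] eventually_gt_at_top[of 0]
  show "\<forall>\<^sub>F n in sequentially. R0 \<le> (\<Sum>i=1..n. real_of_int (renyi_digit i (z 0))) / real n"
  proof eventually_elim
    case (elim n)
    obtain m j where mj: "n = time m + j" "j < a m" using time_split by blast
    have "(R0 + 1) * real n \<le> R * real n" using \<open>R0 + 1 \<le> R\<close> by (intro mult_right_mono) auto
    also have "R * real n = (\<Sum>i<m. R * real (a i) - D) + (D * real m + R * real j)"
      unfolding mj(1) by (simp add: time_def sum_subtractf sum_distrib_left algebra_simps)
    also have "\<dots> \<le> (\<Sum>i<m. real (b i)) + (\<bar>D\<bar> * real m + R * (K * real (Suc m)))"
      using mj(2) K[of m] \<open>0 \<le> R\<close> by (intro add_mono sum_mono D mult_mono) auto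
    also have "\<dots> \<le> (\<Sum>i<m. real (b i)) + Q * real (Suc m)"
      by (simp add: Q_def algebra_simps)
    also have "\<dots> \<le> (\<Sum>i<m. real (b i)) + Q * (1 / Q * real n)"
      using elim(1) mj(1) \<open>0 < Q\<close> by (intro add_left_mono mult_left_mono) auto
    also have "\<dots> \<le> (\<Sum>i=1..n. real_of_int (renyi_digit i (z 0))) + real n"
      using \<open>0 < Q\<close> unfolding mj(1) digit_sum[OF mj(2)] by simp
    finally show ?case using elim(2) by (simp add: le_divide_eq algebra_simps)
  qed
qed

end

section \<open>Continued fractions with sparsely prescribed digits\<close>

text \<open>Two continued fractions with different first digits can be close only if the smaller first
  digit is followed by a tail near 1 and the other by a tail near 0.\<close>

lemma distinct_digits_gap:
  fixes y z Y Z :: real and a b N :: nat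
  assumes y: "y = 1 / (real a + Y)" and z: "z = 1 / (real b + Z)"
    and "a \<noteq> b" "1 \<le> a" "a \<le> N" "1 \<le> b" "b \<le> N"
    and Y: "0 < Y" "Y < 1" and Z: "0 < Z" "Z < 1"
    and gap: "\<bar>Y - Z\<bar> \<le> 1 - 1 / (real N + 1)"
  shows "1 / (real N + 1) ^ 3 \<le> \<bar>y - z\<bar>"
proof -
  have pos: "0 < real a + Y" "0 < real b + Z" using Y Z by auto
  have "1 \<le> \<bar>real a - real b\<bar>" using \<open>a \<noteq> b\<close> by linarith
  then have num: "1 / (real N + 1) \<le> \<bar>(real b + Z) - (real a + Y)\<bar>" using gap by linarith
  have den: "(real a + Y) * (real b + Z) \<le> (real N + 1) * (real N + 1)"
    using assms by (intro mult_mono) auto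
  have "1 / (real N + 1) ^ 3 = (1 / (real N + 1)) / ((real N + 1) * (real N + 1))"
    by (simp add: power3_eq_cube)
  also have "\<dots> \<le> \<bar>(real b + Z) - (real a + Y)\<bar> / ((real a + Y) * (real b + Z))"
    using num den pos by (intro frac_le) auto
  also have "\<dots> = \<bar>y - z\<bar>"
  proof -
    have "y - z = ((real b + Z) - (real a + Y)) / ((real a + Y) * (real b + Z))"
      unfolding y z using pos by (simp add: divide_simps)
    then show ?thesis using pos by (simp add: abs_divide abs_mult)
  qed
  finally show ?thesis .
qed

lemma exists_expansion_factor:
  fixes s :: real
  assumes "s < 1"
  shows "\<exists>N\<ge>1. 1 < 2 powr (1 - s) * (1 - 2 / (real N + 1))"
proof -
  have "(\<lambda>N. 2 powr (1 - s) * (1 - 2 / (real N + 1))) \<longlonglongrightarrow> 2 powr (1 - s) * (1 - 0)"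
    by (intro tendsto_intros) real_asymp
  moreover have "1 < 2 powr (1 - s) * (1 - 0)" using assms by simp
  ultimately have "\<forall>\<^sub>F N in sequentially. 1 < 2 powr (1 - s) * (1 - 2 / (real N + 1))"
    by (rule order_tendstoD(1))
  then have "\<forall>\<^sub>F N in sequentially. 1 < 2 powr (1 - s) * (1 - 2 / (real N + 1)) \<and> 1 \<le> N"
    using eventually_ge_at_top by (rule eventually_conj)
  then show ?thesis using eventually_happens'[OF sequentially_bot] by blast
qed

text \<open>The depth correction of the weights. At a position in \<open>S\<close> the digit is prescribed, and the loss
  of length is compensated by the factor \<open>(c i + 1)\<^sup>2\<close>; at every other position a factor \<open>1 / \<rho>\<close> is
  affordable because the digits up to \<open>N\<close> gain \<open>\<rho>\<close>.\<close>

definition insertion_cost :: "real \<Rightarrow> nat set \<Rightarrow> (nat \<Rightarrow> nat) \<Rightarrow> nat \<Rightarrow> real" where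
  "insertion_cost \<rho> S c n = (\<Prod>i<n. if i \<in> S then (real (c i) + 1)\<^sup>2 else 1 / \<rho>)"

text \<open>The weight of a word is its insertion cost times the \<open>s\<close>-th power of its cylinder length. If the
  gains at free positions outweigh the losses at prescribed ones, in the sense of \<open>cost\<close>, then
  prescribing digits does not lower the dimension below \<open>s\<close>.\<close>

lemma hausdorff_measure_prescribed_digits_nonzero:
  fixes S :: "nat set" and c :: "nat \<Rightarrow> nat" and T :: "real set" and \<rho> s :: real
  assumes s: "0 \<le> s" "s < 1" and c: "\<And>i. 2 \<le> c i" and "1 \<le> N"
    and \<rho>: "1 < \<rho>" "\<rho> \<le> 2 powr (1 - s) * (1 - 2 / (real N + 1))"
    and cost: "insertion_cost \<rho> S c \<longlonglongrightarrow> 0"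
    and T: "\<And>d y. \<lbrakk>cf_tails d y; \<And>i. i \<in> S \<Longrightarrow> d i = c i; \<And>i. i \<notin> S \<Longrightarrow> d i \<le> N\<rbrakk> \<Longrightarrow> y 0 \<in> T"
  shows "hausdorff_measure s T \<noteq> 0"
proof -
  define A where "A n = (if n \<in> S then {c n} else {1..N})" for n
  define y where "y d = (SOME y. cf_tails d y)" for d
  define W where "W = insertion_cost \<rho> S c"
  have A1: "1 \<le> d i" if "\<And>i. d i \<in> A i" for d i
    using that[of i] c[of i] by (auto simp: A_def split: if_splits)
  have tails: "cf_tails d (y d)" if "\<And>i. d i \<in> A i" for d
    unfolding y_def by (rule someI_ex[of "cf_tails d"], rule cf_tails_exist, rule A1, rule that)
  have pre1: "\<forall>a\<in>set (prefix n d). 1 \<le> a" if "\<And>i. d i \<in> A i" for n d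
    using A1[OF that] by (auto simp: prefix_def)
  have W_Suc: "W (Suc n) = W n * (if n \<in> S then (real (c n) + 1)\<^sup>2 else 1 / \<rho>)" for n
    by (simp add: W_def insertion_cost_def)
  have W_pos: "0 < W n" for n
    unfolding W_def insertion_cost_def using \<rho>(1) c by (intro prod_pos) (auto intro!: zero_less_power add_nonneg_pos)
  obtain B where B: "\<And>n. W n \<le> B"
    using convergent_imp_Bseq[OF convergentI[OF cost]] unfolding W_def Bseq_def
    by (metis abs_le_D1 real_norm_def)
  have "0 < B" using B[of 0] W_pos[of 0] by linarith
  define \<kappa> where "\<kappa> = 1 / (real N + 1) ^ 3"
  have "0 < \<kappa>" by (simp add: \<kappa>_def)
  interpret weighted_tree A "\<lambda>w. W (length w) * cylinder_size w powr s" "\<lambda>d. y d 0" s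
    "B * (2 / \<kappa>) powr s"
  proof
    show "finite (A n)" "A n \<noteq> {}" for n using \<open>1 \<le> N\<close> by (auto simp: A_def)
    show "0 \<le> W (length w) * cylinder_size w powr s" for w using W_pos[of "length w"] by simp
    show "0 < W (length ([]::nat list)) * cylinder_size [] powr s"
      using W_pos[of 0] by (simp add: cylinder_size_def denoms_def)
    show "0 \<le> s" by fact
    show "0 < B * (2 / \<kappa>) powr s" using \<open>0 < B\<close> \<open>0 < \<kappa>\<close> by simp
  next
    fix d n assume d: "\<And>i. d i \<in> A i"
    let ?w = "prefix n d"
    show "W (length ?w) * cylinder_size ?w powr s
      \<le> (\<Sum>a\<in>A n. W (length (?w @ [a])) * cylinder_size (?w @ [a]) powr s)"
    proof (cases "n \<in> S")
      case True
      have "1 \<le> c n" using c[of n] by simp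
      have pos: "0 < cylinder_size ?w" by (rule cylinder_size_pos(1)[OF pre1[OF d]])
      have "cylinder_size ?w powr s \<le> ((real (c n) + 1)\<^sup>2 * cylinder_size (?w @ [c n])) powr s"
        using pos s by (intro powr_mono2 cylinder_size_snoc_ge pre1 d \<open>1 \<le> c n\<close>) auto
      also have "\<dots> = (real (c n) + 1)\<^sup>2 powr s * cylinder_size (?w @ [c n]) powr s"
        by (rule powr_mult)
      also have "\<dots> \<le> (real (c n) + 1)\<^sup>2 powr 1 * cylinder_size (?w @ [c n]) powr s"
        using s by (intro mult_right_mono powr_mono) auto
      finally have "W n * cylinder_size ?w powr s
          \<le> W n * ((real (c n) + 1)\<^sup>2 * cylinder_size (?w @ [c n]) powr s)"
        using W_pos[of n] by simp
      then show ?thesis using True by (simp add: A_def W_Suc mult.assoc)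
    next
      case False
      have "\<rho> * cylinder_size ?w powr s
          \<le> 2 powr (1 - s) * (1 - 2 / (real N + 1)) * cylinder_size ?w powr s"
        using \<rho>(2) by (rule mult_right_mono) simp
      also have "\<dots> \<le> (\<Sum>a\<in>{1..N}. cylinder_size (?w @ [a]) powr s)"
        by (rule cylinder_size_powr_le_sum_children[OF pre1[OF d] s])
      finally have "W n / \<rho> * (\<rho> * cylinder_size ?w powr s)
          \<le> W n / \<rho> * (\<Sum>a\<in>{1..N}. cylinder_size (?w @ [a]) powr s)"
        using W_pos[of n] \<rho>(1) by (intro mult_left_mono) auto
      then show ?thesis using False \<rho>(1) by (simp add: A_def W_Suc sum_distrib_left)
    qed
  next
    fix d assume d: "\<And>i. d i \<in> A i"
    have size: "cylinder_size (prefix n d) powr s \<le> 1" for n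
      using cylinder_size_pos[OF pre1[OF d], of n] s by (intro powr_le1) auto
    show "(\<lambda>n. W (length (prefix n d)) * cylinder_size (prefix n d) powr s) \<longlonglongrightarrow> 0"
    proof (rule tendsto_sandwich)
      show "(\<lambda>n. 0::real) \<longlonglongrightarrow> 0" by simp
      show "W \<longlonglongrightarrow> 0" unfolding W_def by (rule cost)
    qed (use W_pos size in \<open>auto simp: less_imp_le intro!: always_eventually mult_left_le\<close>)
  next
    fix d e n
    assume d: "\<And>i. d i \<in> A i" and e: "\<And>i. e i \<in> A i"
      and same: "prefix n d = prefix n e" and "d n \<noteq> e n"
    note td = cf_tailsD[OF tails[OF d]] and te = cf_tailsD[OF tails[OF e]]
    have "n \<notin> S" using d[of n] e[of n] \<open>d n \<noteq> e n\<close> by (auto simp: A_def)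
    \<comment> \<open>Branches can only differ at free positions.\<close>
    then have free: "1 \<le> d n" "d n \<le> N" "1 \<le> e n" "e n \<le> N"
      using d[of n] e[of n] by (auto simp: A_def)
    have gap: "\<bar>y d (Suc n) - y e (Suc n)\<bar> \<le> 1 - 1 / (real N + 1)"
    \<comment> \<open>Both tails start at the same position, so either both first digits are prescribed or both
      are at most \<open>N\<close>.\<close>
    proof (cases "Suc n \<in> S")
      case True
      \<comment> \<open>Here \<open>2 \<le> c i\<close> enters: both tails are at most 1/2, so they cannot be near 0 and 1.\<close>
      have "2 \<le> d (Suc n)" "2 \<le> e (Suc n)" using True d[of "Suc n"] e[of "Suc n"] c by (auto simp: A_def)
      then have "y d (Suc n) \<le> 1 / 2" "y e (Suc n) \<le> 1 / 2"
        using td(2)[of "Suc (Suc n)"] te(2)[of "Suc (Suc n)"]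
        unfolding td(4)[of "Suc n"] te(4)[of "Suc n"] by (auto intro!: divide_left_mono)
      moreover have "1 / (real N + 1) \<le> 1 / 2" using \<open>1 \<le> N\<close> by simp
      ultimately show ?thesis using td(2)[of "Suc n"] te(2)[of "Suc n"] by linarith
    next
      case False
      then have "d (Suc n) \<le> N" "e (Suc n) \<le> N" using d[of "Suc n"] e[of "Suc n"] by (auto simp: A_def)
      then have "1 / (real N + 1) \<le> y d (Suc n)" "1 / (real N + 1) \<le> y e (Suc n)"
        using td(2,3)[of "Suc (Suc n)"] te(2,3)[of "Suc (Suc n)"] td(1)[of "Suc n"] te(1)[of "Suc n"]
        unfolding td(4)[of "Suc n"] te(4)[of "Suc n"] by (auto intro!: divide_left_mono add_mono mult_pos_pos add_pos_pos)
      then show ?thesis using td(3)[of "Suc n"] te(3)[of "Suc n"] by linarith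
    qed
    have "\<kappa> \<le> \<bar>y d n - y e n\<bar>"
      unfolding \<kappa>_def
      by (rule distinct_digits_gap[OF td(4) te(4) \<open>d n \<noteq> e n\<close> free td(2,3) te(2,3) gap])
    then have "\<kappa> * cylinder_size (prefix n d) \<le> \<bar>y d n - y e n\<bar> * cylinder_size (prefix n d)"
      using cylinder_size_pos(1)[OF pre1[OF d], of n] by (intro mult_right_mono) auto
    also have "\<dots> \<le> 2 * \<bar>y d 0 - y e 0\<bar>"
      by (rule cylinder_size_le_dist[OF tails[OF d] tails[OF e] same])
    finally have le: "cylinder_size (prefix n d) \<le> 2 / \<kappa> * dist (y d 0) (y e 0)"
      using \<open>0 < \<kappa>\<close> by (simp add: dist_real_def field_simps)
    have "cylinder_size (prefix n d) powr s \<le> (2 / \<kappa> * dist (y d 0) (y e 0)) powr s"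
      using le cylinder_size_pos(1)[OF pre1[OF d], of n] s by (intro powr_mono2) auto
    also have "\<dots> = (2 / \<kappa>) powr s * dist (y d 0) (y e 0) powr s"
      by (rule powr_mult)
    finally have "W n * cylinder_size (prefix n d) powr s
        \<le> B * ((2 / \<kappa>) powr s * dist (y d 0) (y e 0) powr s)"
      using B[of n] W_pos[of n] \<open>0 < B\<close> by (intro mult_mono) auto
    then show "W (length (prefix n d)) * cylinder_size (prefix n d) powr s
        \<le> B * (2 / \<kappa>) powr s * dist (y d 0) (y e 0) powr s"
      by (simp add: mult.assoc)
  qed
  have "(\<lambda>d. y d 0) ` branches \<subseteq> T"
  proof clarify
    fix d assume d: "\<forall>i. d i \<in> A i"
    then have "d i = c i" if "i \<in> S" for i using that by (auto simp: A_def split: if_splits dest!: spec[of _ i])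
    moreover have "d i \<le> N" if "i \<notin> S" for i using that d by (auto simp: A_def split: if_splits dest!: spec[of _ i])
    ultimately show "y d 0 \<in> T" using d by (intro T[OF tails]) auto
  qed
  from hausdorff_measure_mono[OF this, of s] show ?thesis
    using hausdorff_measure_branches_nonzero by auto
qed

section \<open>Prescribing digits in the pairs with square index\<close>

definition square_index :: "nat \<Rightarrow> bool" where
  "square_index i \<longleftrightarrow> (\<exists>k. i = k\<^sup>2)"

text \<open>Digits are numbered individually and pairs by \<open>i div 2\<close>, which gives two positions for
  every square.\<close>

lemma card_square_positions:
  "real (card {i. i < n \<and> square_index (i div 2)}) \<le> 2 * sqrt (real n) + 2"
proof -
  define r where "r = nat \<lfloor>sqrt (real n)\<rfloor>"
  have "{i. i < n \<and> square_index (i div 2)} \<subseteq> (\<lambda>(k, e). 2 * k\<^sup>2 + e) ` ({..r} \<times> {..1})"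
  proof
    fix i assume "i \<in> {i. i < n \<and> square_index (i div 2)}"
    then obtain k where k: "i < n" "i div 2 = k\<^sup>2" by (auto simp: square_index_def)
    have "k\<^sup>2 \<le> n" using k by linarith
    then have "(real k)\<^sup>2 \<le> real n" by (metis of_nat_le_iff of_nat_power)
    then have "real k \<le> sqrt (real n)" by (rule real_le_rsqrt)
    then have "k \<le> r" unfolding r_def by (simp add: le_nat_floor)
    moreover have "i = 2 * k\<^sup>2 + i mod 2" using k(2) by (metis mult_div_mod_eq)
    moreover have "i mod 2 \<le> 1" by simp
    ultimately show "i \<in> (\<lambda>(k, e). 2 * k\<^sup>2 + e) ` ({..r} \<times> {..1})"
      by (intro image_eqI[of _ _ "(k, i mod 2)"]) auto
  qed
  then have "card {i. i < n \<and> square_index (i div 2)} \<le> card ({..r} \<times> {..1::nat})"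
    by (intro surj_card_le) auto
  also have "\<dots> = 2 * (r + 1)" by (simp add: card_cartesian_product)
  finally have "real (card {i. i < n \<and> square_index (i div 2)}) \<le> real (2 * (r + 1))"
    by (rule of_nat_mono)
  also have "\<dots> \<le> 2 * sqrt (real n) + 2"
    by (simp add: r_def)
  finally show ?thesis .
qed

text \<open>Squares are sparse: about \<open>2 * sqrt n\<close> factors of polynomial size are no match
  for the exponentially small factor \<open>\<rho> powr (- n)\<close>.\<close>

lemma insertion_cost_squares:
  assumes "1 < \<rho>" and c: "\<And>i. real (c i) + 1 \<le> Q * (real i + 1)\<^sup>2"
  shows "insertion_cost \<rho> {i. square_index (i div 2)} c \<longlonglongrightarrow> 0"
proof -
  define l where "l = ln \<rho>"
  define M where "M = 2 * ln Q + l"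
  have "0 < l" using assms by (simp add: l_def)
  have "1 \<le> Q" using c[of 0] by simp
  \<comment> \<open>A prescribed position, compared with a free one, costs at most the extra factor \<open>X n\<close>.\<close>
  define X where "X n = \<rho> * (Q * (real n + 1)\<^sup>2)\<^sup>2" for n :: nat
  have X: "X n = exp (2 * ln Q + l + 4 * ln (real n + 1))" for n
  proof -
    have "exp (2 * ln Q + l + 4 * ln (real n + 1)) = exp (ln Q)^2 * exp l * exp (ln (real n + 1))^4"
      using exp_of_nat_mult[of 2 "ln Q"] exp_of_nat_mult[of 4 "ln (real n + 1)"]
      by (simp add: exp_add)
    then show ?thesis using \<open>1 \<le> Q\<close> \<open>1 < \<rho>\<close> by (simp add: X_def l_def power_mult_distrib)
  qed
  have "insertion_cost \<rho> {i. square_index (i div 2)} c n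
      \<le> exp (- l * real n + (2 * sqrt (real n) + 2) * (M + 4 * ln (real n + 1)))" for n
  proof -
    define k where "k = card {i. i < n \<and> square_index (i div 2)}"
    have "insertion_cost \<rho> {i. square_index (i div 2)} c n
        \<le> (\<Prod>i<n. 1 / \<rho> * (if square_index (i div 2) then X n else 1))"
      unfolding insertion_cost_def
    proof (rule prod_mono, safe)
      fix i assume "i < n"
      have "(real (c i) + 1)\<^sup>2 \<le> (Q * (real n + 1)\<^sup>2)\<^sup>2"
        using c[of i] \<open>i < n\<close> \<open>1 \<le> Q\<close>
        by (intro power_mono order_trans[OF c[of i]] mult_left_mono) auto
      then show "(if i \<in> {i. square_index (i div 2)} then (real (c i) + 1)\<^sup>2 else 1 / \<rho>)
          \<le> 1 / \<rho> * (if square_index (i div 2) then X n else 1)"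
        using \<open>1 < \<rho>\<close> by (simp add: X_def)
      show "0 \<le> (if i \<in> {i. square_index (i div 2)} then (real (c i) + 1)\<^sup>2 else 1 / \<rho>)"
        using \<open>1 < \<rho>\<close> by simp
    qed
    also have "\<dots> = (\<Prod>i<n. 1 / \<rho>) * (\<Prod>i<n. if square_index (i div 2) then X n else 1)"
      by (rule prod.distrib)
    also have "(\<Prod>i<n. if square_index (i div 2) then X n else 1) = X n ^ k"
      by (simp add: prod.If_cases k_def lessThan_def Int_def)
    also have "(\<Prod>i<n. 1 / \<rho>) = (1 / \<rho>) ^ n" by simp
    also have "(1 / \<rho>) ^ n * X n ^ k = exp (- l * real n) * exp (real k * (2 * ln Q + l + 4 * ln (real n + 1)))"
    proof -
      have "exp (- l * real n) = exp (- l) ^ n" by (metis exp_of_nat_mult mult.commute)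
      also have "exp (- l) = 1 / \<rho>" using \<open>1 < \<rho>\<close> by (simp add: l_def exp_minus inverse_eq_divide)
      finally show ?thesis by (simp only: X exp_of_nat_mult)
    qed
    also have "\<dots> \<le> exp (- l * real n) * exp ((2 * sqrt (real n) + 2) * (M + 4 * ln (real n + 1)))"
      using card_square_positions[of n] \<open>0 < l\<close> \<open>1 \<le> Q\<close>
      by (intro mult_left_mono iffD2[OF exp_le_cancel_iff] mult_mono') (auto simp: M_def k_def)
    finally show ?thesis unfolding exp_add .
  qed
  note upper = this
  show ?thesis
  proof (rule tendsto_sandwich)
    show "\<forall>\<^sub>F n in sequentially. 0 \<le> insertion_cost \<rho> {i. square_index (i div 2)} c n"
      using assms by (simp add: insertion_cost_def prod_nonneg)
    show "\<forall>\<^sub>F n in sequentially. insertion_cost \<rho> {i. square_index (i div 2)} c n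
        \<le> exp (- l * real n + (2 * sqrt (real n) + 2) * (M + 4 * ln (real n + 1)))"
      using upper by simp
    show "(\<lambda>n. exp (- l * real n + (2 * sqrt (real n) + 2) * (M + 4 * ln (real n + 1)))) \<longlonglongrightarrow> 0"
      using \<open>0 < l\<close> by real_asymp
  qed simp
qed

lemma cube_le_sum_squares: "real r ^ 3 \<le> 3 * (\<Sum>k\<le>r. (real k)\<^sup>2)"
proof (induction r)
  case (Suc r)
  have "real (Suc r) ^ 3 \<le> real r ^ 3 + 3 * (real (Suc r))\<^sup>2"
    by (simp add: power3_eq_cube power2_eq_square algebra_simps)
  then show ?case using Suc by (simp add: distrib_left)
qed simp

text \<open>Squares are nevertheless frequent enough: a block of length at least \<open>i\<close> at every square index \<open>i\<close>
  makes the first \<open>m\<close> blocks last at least a constant times \<open>m powr (3/2)\<close>.\<close>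

lemma rare_ends_of_squares:
  fixes a :: "nat \<Rightarrow> nat"
  assumes a: "\<And>i. square_index i \<Longrightarrow> i \<le> a i" and "0 < \<epsilon>"
  shows "\<forall>\<^sub>F m in sequentially. real (Suc m) \<le> \<epsilon> * (\<Sum>i<m. real (a i))"
proof -
  have bound: "(sqrt (real m - 1) - 1) ^ 3 / 3 \<le> (\<Sum>i<m. real (a i))" if "2 \<le> m" for m
  proof -
    define r where "r = nat \<lfloor>sqrt (real m - 1)\<rfloor>"
    have r: "real r \<le> sqrt (real m - 1)" "sqrt (real m - 1) - 1 \<le> real r"
      using that by (auto simp: r_def)
    have sq: "k\<^sup>2 < m" if "k \<le> r" for k
    proof -
      have "(real k)\<^sup>2 \<le> (sqrt (real m - 1))\<^sup>2" using r(1) that by (intro power_mono) auto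
      also have "\<dots> < real m" using \<open>2 \<le> m\<close> by simp
      finally have "real (k\<^sup>2) < real m" by (simp only: of_nat_power)
      then show ?thesis by (simp only: of_nat_less_iff)
    qed
    have "(sqrt (real m - 1) - 1) ^ 3 \<le> real r ^ 3"
      using r that by (intro power_mono) auto
    also have "\<dots> \<le> 3 * (\<Sum>k\<le>r. (real k)\<^sup>2)" by (rule cube_le_sum_squares)
    also have "(\<Sum>k\<le>r. (real k)\<^sup>2) = (\<Sum>i\<in>(\<lambda>k. k\<^sup>2) ` {..r}. real i)"
      by (subst sum.reindex) (auto simp: inj_on_def)
    also have "\<dots> \<le> (\<Sum>i\<in>(\<lambda>k. k\<^sup>2) ` {..r}. real (a i))"
      using a by (intro sum_mono) (auto simp: square_index_def)
    also have "\<dots> \<le> (\<Sum>i<m. real (a i))"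
      using sq by (intro sum_mono2) auto
    finally show ?thesis by simp
  qed
  have "\<forall>\<^sub>F m in sequentially. real (Suc m) \<le> \<epsilon> * ((sqrt (real m - 1) - 1) ^ 3 / 3)"
    using \<open>0 < \<epsilon>\<close> by real_asymp
  then show ?thesis using eventually_ge_at_top[of 2]
  proof eventually_elim
    case (elim m)
    then show ?case using bound[of m] \<open>0 < \<epsilon>\<close>
      by (meson less_imp_le mult_left_mono order_trans)
  qed
qed

text \<open>A subset of \<open>[0, 1)\<close> has full dimension as soon as it contains, for every \<open>N\<close>, all points whose block
  parameters are \<open>(i + 2, L i)\<close> at square indices \<open>i\<close> and at most \<open>N\<close> elsewhere: for each \<open>s < 1\<close>
  a suitable \<open>N\<close> provides a subset of nonzero \<open>s\<close>-dimensional measure.\<close>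

lemma hausdorff_dim_eq_1_of_inserted_blocks:
  fixes T :: "real set" and L :: "nat \<Rightarrow> nat"
  assumes "T \<subseteq> {0..<1}" and L: "\<And>i. 2 \<le> L i" "\<And>i. real (L i) + 1 \<le> Q * (real i + 1)\<^sup>2"
    and T: "\<And>N a b z. \<lbrakk>renyi_blocks a b z; z 0 \<notin> \<rat>; 0 < z 0; z 0 < 1;
        \<And>i. square_index i \<Longrightarrow> a i = i + 2 \<and> b i = L i;
        \<And>i. \<not> square_index i \<Longrightarrow> a i \<le> N \<and> b i \<le> N\<rbrakk> \<Longrightarrow> z 0 \<in> T"
  shows "hausdorff_dim T = 1"
proof (rule antisym)
  show "hausdorff_dim T \<le> 1" by (rule hausdorff_dim_le_1) fact
  have "hausdorff_measure s T \<noteq> 0" if "0 \<le> s" "s < 1" for s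
  proof -
    define c where "c n = (if even n then n div 2 + 2 else L (n div 2))" for n
    obtain N where "1 \<le> N" and \<rho>: "1 < 2 powr (1 - s) * (1 - 2 / (real N + 1))"
      using exists_expansion_factor \<open>s < 1\<close> by blast
    show ?thesis
    proof (rule hausdorff_measure_prescribed_digits_nonzero[OF that _ \<open>1 \<le> N\<close> \<rho> order_refl])
      show "2 \<le> c i" for i using L(1) by (simp add: c_def)
      have "real (c i) + 1 \<le> (Q + 3) * (real i + 1)\<^sup>2" for i
      proof -
        have "0 \<le> Q" using L(2)[of 0] by simp
        have le: "real (i div 2) \<le> real i" by simp
        have sq: "real i + 1 \<le> (real i + 1)\<^sup>2" by (simp add: power2_eq_square)
        show ?thesis
        proof (cases "even i")
          case True
          have "real (c i) + 1 \<le> 3 * (real i + 1)\<^sup>2" using True le sq by (simp add: c_def)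
          then show ?thesis using \<open>0 \<le> Q\<close> by (simp add: distrib_right add_increasing)
        next
          case False
          have "real (c i) + 1 \<le> Q * (real (i div 2) + 1)\<^sup>2" using False L(2) by (simp add: c_def)
          also have "\<dots> \<le> (Q + 3) * (real i + 1)\<^sup>2"
            using le \<open>0 \<le> Q\<close> by (intro mult_mono power_mono) auto
          finally show ?thesis .
        qed
      qed
      then show "insertion_cost (2 powr (1 - s) * (1 - 2 / (real N + 1))) {i. square_index (i div 2)} c
          \<longlonglongrightarrow> 0"
        by (rule insertion_cost_squares[OF \<rho>])
    next
      fix d y assume tails: "cf_tails d y"
        and ins: "\<And>i. i \<in> {i. square_index (i div 2)} \<Longrightarrow> d i = c i"
        and free: "\<And>i. i \<notin> {i. square_index (i div 2)} \<Longrightarrow> d i \<le> N"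
      define a b z where "a i = d (2 * i)" and "b i = d (2 * i + 1)" and "z i = y (2 * i)" for i
      have ab: "a i = i + 2 \<and> b i = L i" if "square_index i" for i
        using ins[of "2 * i"] ins[of "2 * i + 1"] that by (simp add: a_def b_def c_def)
      have "renyi_block (a i) (b i) (z (Suc i)) (z i)" for i
      proof
        show "1 \<le> a i" "1 \<le> b i" "0 < z (Suc i)" "z (Suc i) < 1"
          unfolding a_def b_def z_def by (rule cf_tailsD[OF tails])+
        show "z i = 1 / (real (a i) + 1 / (real (b i) + z (Suc i)))"
          using cf_tailsD(4)[OF tails, of "2 * i"] cf_tailsD(4)[OF tails, of "2 * i + 1"]
          by (simp add: a_def b_def z_def)
      qed
      moreover have "\<forall>\<^sub>F m in sequentially. real (Suc m) \<le> \<epsilon> * (\<Sum>i<m. real (a i))" if "0 < \<epsilon>" for \<epsilon>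
        by (rule rare_ends_of_squares[OF _ that]) (simp add: ab)
      ultimately have "renyi_blocks a b z" by (rule renyi_blocks.intro)
      then have "z 0 \<in> T"
        using cf_tails_irrational[OF tails, of 0] cf_tailsD(2,3)[OF tails, of 0] ab
          free[of "2 * i" for i] free[of "2 * i + 1" for i]
        by (intro T[of a b z N]) (auto simp: z_def a_def b_def)
      then show "y 0 \<in> T" by (simp add: z_def)
    qed
  qed
  then show "1 \<le> hausdorff_dim T"
    unfolding hausdorff_dim_def by (intro INF_greatest) (force simp: not_less[symmetric])
qed

text \<open>It remains to choose \<open>L\<close>. Long blocks have length \<open>a = i + 2\<close>, and mean digit \<open>2 + \<beta>\<close> calls for an excess
  \<open>b\<close> of about \<open>\<beta> * a\<close>, so \<open>L i\<close> is \<open>\<beta> * i\<close> rounded up; for an infinite mean \<open>L i\<close> grows like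
  \<open>i\<^sup>2\<close>, still polynomially. Adding 2 keeps the prescribed digits at least 2.\<close>

theorem theorem1p1:
  fixes \<alpha> :: ereal and \<phi> :: "nat \<Rightarrow> real \<Rightarrow> real"
  assumes "2 \<le> \<alpha>"
    and "\<And>i. 1 \<le> i \<Longrightarrow> \<phi> i \<in> mild_distortion"
    and "\<And>i. 1 \<le> i \<Longrightarrow> bounded (\<phi> i ` {0..<1})"
  shows "hausdorff_dim {x \<in> {0<..<1} - \<rat>.
           (\<forall>i\<ge>1. (\<lambda>n. birkhoff_sum n (\<phi> i) x / real n) \<longlonglongrightarrow> \<phi> i 0) \<and>
           (\<lambda>n. ln \<bar>deriv (renyi ^^ n) x\<bar> / real n) \<longlonglongrightarrow> 0 \<and>
           (\<lambda>n. ereal ((\<Sum>j=1..n. real_of_int (renyi_digit j x)) / real n)) \<longlonglongrightarrow> \<alpha>} = 1"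
    (is "hausdorff_dim ?T = 1")
proof -
  have member: "z 0 \<in> ?T"
    if "renyi_blocks a b z" "z 0 \<notin> \<rat>" "0 < z 0" "z 0 < 1"
      and ins: "\<And>i. square_index i \<Longrightarrow> a i = i + 2 \<and> b i = L i"
      and free: "\<And>i. \<not> square_index i \<Longrightarrow> a i \<le> N \<and> b i \<le> N"
      and L: "\<And>i. real (L i) + 1 \<le> Q * (real i + 1)\<^sup>2"
      and digits: "\<lbrakk>\<And>i. real (a i) \<le> real (N + 2) * real (Suc i)\<rbrakk> \<Longrightarrow>
        (\<lambda>n. ereal ((\<Sum>j=1..n. real_of_int (renyi_digit j (z 0))) / real n)) \<longlonglongrightarrow> \<alpha>"
    for a b z N Q and L :: "nat \<Rightarrow> nat"
  proof -
    interpret renyi_blocks a b z by fact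
    have "real (a i) \<le> real (N + 2) * real (Suc i)" for i
    proof -
      have "a i \<le> (N + 2) * Suc i"
      proof (cases "square_index i")
        case True
        then show ?thesis using ins[OF True] by (simp add: algebra_simps)
      next
        case False
        then show ?thesis using free[OF False] by (simp add: algebra_simps)
      qed
      then show ?thesis by (metis of_nat_le_iff of_nat_mult)
    qed
    note digits = digits[OF this]
    have "0 \<le> Q" using L[of 0] by simp
    have "real (b i) + 1 \<le> (Q + real N + 1) * (real (a i) + 1)\<^sup>2" for i
    proof (cases "square_index i")
      case True
      have "real (b i) + 1 \<le> Q * (real i + 1)\<^sup>2" using ins[OF True] L by simp
      also have "\<dots> \<le> (Q + real N + 1) * (real (a i) + 1)\<^sup>2"
        using ins[OF True] \<open>0 \<le> Q\<close> by (intro mult_mono power_mono) auto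
      finally show ?thesis .
    next
      case False
      have "real (b i) + 1 \<le> (Q + real N + 1) * 1" using free[OF False] \<open>0 \<le> Q\<close> by simp
      also have "\<dots> \<le> (Q + real N + 1) * (real (a i) + 1)\<^sup>2"
        using \<open>0 \<le> Q\<close> by (intro mult_left_mono) (auto intro: one_le_power)
      finally show ?thesis .
    qed
    from log_deriv_average_tendsto[OF this] digits mild_average_tendsto assms(2,3) that(2,3,4)
    show ?thesis by auto
  qed
  have subset: "?T \<subseteq> {0..<1}" by auto
  show ?thesis
  proof (cases \<alpha>)
    case (real r)
    define \<beta> where "\<beta> = r - 2"
    have "0 \<le> \<beta>" "\<alpha> = ereal (2 + \<beta>)" using assms(1) real by (auto simp: \<beta>_def)
    define L where "L i = nat \<lceil>\<beta> * real i\<rceil> + 2" for i :: nat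
    have L: "\<beta> * real i + 2 \<le> real (L i)" "real (L i) \<le> \<beta> * real i + 3" for i
    proof -
      have "real (L i) = of_int \<lceil>\<beta> * real i\<rceil> + 2" using \<open>0 \<le> \<beta>\<close> by (simp add: L_def)
      then show "\<beta> * real i + 2 \<le> real (L i)" "real (L i) \<le> \<beta> * real i + 3" by linarith+
    qed
    show ?thesis
    proof (rule hausdorff_dim_eq_1_of_inserted_blocks[OF subset])
      show "2 \<le> L i" for i by (simp add: L_def)
      show L_le: "real (L i) + 1 \<le> (\<beta> + 4) * (real i + 1)\<^sup>2" for i
      proof -
        have "real (L i) + 1 \<le> (\<beta> + 4) * (real i + 1)" using L(2)[of i] \<open>0 \<le> \<beta>\<close> by (simp add: algebra_simps)
        also have "\<dots> \<le> (\<beta> + 4) * (real i + 1)\<^sup>2"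
          using \<open>0 \<le> \<beta>\<close> by (intro mult_left_mono) (auto simp: power2_eq_square)
        finally show ?thesis .
      qed
      fix N a b z
      assume z: "renyi_blocks a b z" "z 0 \<notin> \<rat>" "0 < z 0" "z 0 < 1"
        and ins: "\<And>i. square_index i \<Longrightarrow> a i = i + 2 \<and> b i = L i"
        and free: "\<And>i. \<not> square_index i \<Longrightarrow> a i \<le> N \<and> b i \<le> N"
      interpret renyi_blocks a b z by fact
      show "z 0 \<in> ?T"
      proof (rule member[OF z ins free L_le])
        assume K: "\<And>i. real (a i) \<le> real (N + 2) * real (Suc i)"
        have "\<bar>real (b i) - \<beta> * real (a i)\<bar> \<le> real N + \<beta> * real N + 3 + 2 * \<beta>" for i
        proof (cases "square_index i")
          case True
          have "real (b i) - \<beta> * real (a i) = real (L i) - \<beta> * real i - 2 * \<beta>"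
            using ins[OF True] by (simp add: algebra_simps)
          moreover have "0 \<le> \<beta> * real N" using \<open>0 \<le> \<beta>\<close> by simp
          ultimately show ?thesis using L[of i] \<open>0 \<le> \<beta>\<close> by linarith
        next
          case False
          have "\<beta> * real (a i) \<le> \<beta> * real N" "real (b i) \<le> real N" "0 \<le> \<beta> * real (a i)"
            using free[OF False] \<open>0 \<le> \<beta>\<close> by (auto intro: mult_left_mono)
          then show ?thesis using \<open>0 \<le> \<beta>\<close> by linarith
        qed
        from digit_average_tendsto[OF K \<open>0 \<le> \<beta>\<close> this]
        show "(\<lambda>n. ereal ((\<Sum>j=1..n. real_of_int (renyi_digit j (z 0))) / real n)) \<longlonglongrightarrow> \<alpha>"
          unfolding \<open>\<alpha> = ereal (2 + \<beta>)\<close> by (rule tendsto_ereal)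
      qed
    qed
  next
    case PInf
    define L where "L i = i\<^sup>2 + 2" for i :: nat
    show ?thesis
    proof (rule hausdorff_dim_eq_1_of_inserted_blocks[OF subset])
      show "2 \<le> L i" for i by (simp add: L_def)
      show L_le: "real (L i) + 1 \<le> 3 * (real i + 1)\<^sup>2" for i
        by (simp add: L_def power2_eq_square algebra_simps)
      fix N a b z
      assume z: "renyi_blocks a b z" "z 0 \<notin> \<rat>" "0 < z 0" "z 0 < 1"
        and ins: "\<And>i. square_index i \<Longrightarrow> a i = i + 2 \<and> b i = L i"
        and free: "\<And>i. \<not> square_index i \<Longrightarrow> a i \<le> N \<and> b i \<le> N"
      interpret renyi_blocks a b z by fact
      show "z 0 \<in> ?T"
      proof (rule member[OF z ins free L_le])
        assume K: "\<And>i. real (a i) \<le> real (N + 2) * real (Suc i)"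
        have "\<exists>D. \<forall>i. R * real (a i) - D \<le> real (b i)" if "0 \<le> R" for R
        proof (intro exI allI)
          fix i
          show "R * real (a i) - (R * real N + 2 * R + R\<^sup>2) \<le> real (b i)"
          proof (cases "square_index i")
            case True
            have "R * real (a i) = R * real i + 2 * R" "real (b i) = (real i)\<^sup>2 + 2"
              using ins[OF True] by (simp_all add: L_def algebra_simps)
            moreover have "2 * (R * real i) \<le> R\<^sup>2 + (real i)\<^sup>2"
              using sum_squares_bound[of R "real i"] by simp
            moreover have "0 \<le> R * real i" "0 \<le> R * real N" using that by auto
            ultimately show ?thesis using that by linarith
          next
            case False
            have "R * real (a i) \<le> R * real N"
              using free[OF False] that by (intro mult_left_mono) auto
            moreover have "0 \<le> R\<^sup>2" "0 \<le> real (b i)" by auto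
            ultimately show ?thesis using that by linarith
          qed
        qed
        from digit_average_tendsto_infinity[OF K this]
        show "(\<lambda>n. ereal ((\<Sum>j=1..n. real_of_int (renyi_digit j (z 0))) / real n)) \<longlonglongrightarrow> \<alpha>"
          unfolding PInf .
      qed
    qed
  next
    case MInf
    then show ?thesis using assms(1) by simp
  qed
qed

end
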